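(* Let the disturbances $w_t$ be chosen by an adversary from a bounded set $\Omega\subseteq\mathbb{R}^n$. Then the optimal dynamic regret with $k$ predictions over horizon $T$ ($1\le k\le T$) satisfies $${\mathit{Reg}^A_k}^* = O(\|F^k\|^2\, T + 1) = O(\lambda^{2k}\, T + 1).$$ Moreover, there exist $A$, $B$, $Q$, $R$, $Q_f$, $x_0$, and a bounded set $\Omega$ such that ${\mathit{Reg}^A_k}^*$ is bounded below by order $\|F^k\|^2 (T - k)$, i.e. there is a constant $C>0$ with ${\mathit{Reg}^A_k}^*\ge C\,\|F^k\|^2 (T - k)$ for all $1\le k\le T$. The constants do not depend on $k$ or $T$.
   Context: System and cost: $x_{t+1} = A x_t + B u_t + w_t$ with $x_t\in\mathbb{R}^n$, $u_t\in\mathbb{R}^d$, given $x_0$, and for horizon $T\ge1$ the cost is $J(u,w) = \sum_{t=0}^{T-1} (x_t^\top Q x_t + u_t^\top R u_t) + x_T^\top Q_f x_T$. Standing assumptions: $Q,Q_f\succeq 0$, $R\succ 0$ (symmetric); $(A,B)$ is stabilizable, i.e. there is $K_0$ with $\rho(A-BK_0)<1$ ($\rho$ = spectral radius); $(A,Q)$ is detectable, i.e. $(A^\top,Q)$ is stabilizable. $P$ is the (unique positive semidefinite) solution of $P = Q + A^\top P A - A^\top P B(R + B^\top P B)^{-1} B^\top PA$; $F=A-B(R+B^\top PB)^{-1}B^\top PA$, which satisfies $\rho(F)<1$; $\lambda=\frac{1+\rho(F)}2<1$. $\|\cdot\|$ is the spectral norm. Optimal dynamic regret with $k$ (exact) predictions,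 all suprema being over $\Omega$: $${\mathit{Reg}^A_k}^* = \sup_{w_0, \dots, w_{k-1}} \min_{u_0} \sup_{w_k} \cdots \min_{u_{T-k-1}} \sup_{w_{T-1}} \min_{u_{T-k}, \dots, u_{T-1}} \Big(J(u, w) - \min_{u'_0, \dots, u'_{T-1}} J(u', w)\Big).$$ Notation: $f=O(g)$ means $|f|\le C\,g$ for a constant $C>0$ and all admissible $k$ and $T$. *)

theory Defs
  imports "HOL-Analysis.Analysis"
begin

(* The operations that the type real^'n inherits from its components act entrywise, so
   matrix powers are iterated matrix products (**). *)
primrec mat_pow :: "real^'n^'n \<Rightarrow> nat \<Rightarrow> real^'n^'n" where
  "mat_pow M 0 = mat 1"
| "mat_pow M (Suc k) = M ** mat_pow M k"

definition spectral_norm :: "real^'n^'m \<Rightarrow> real" where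
  "spectral_norm M = onorm ((*v) M)"

(* Eigenvalues of a real matrix are taken over the complex numbers. *)
definition eigenvalues :: "real^'n^'n \<Rightarrow> complex set" where
  "eigenvalues M = {c. \<exists>v. v \<noteq> 0 \<and> map_matrix complex_of_real M *v v = c *s v}"

definition spectral_radius :: "real^'n^'n \<Rightarrow> real" where
  "spectral_radius M = Max (cmod ` eigenvalues M)"

definition pos_semidef :: "real^'n^'n \<Rightarrow> bool" where
  "pos_semidef M \<longleftrightarrow> transpose M = M \<and> (\<forall>x. 0 \<le> x \<bullet> (M *v x))"

definition pos_def :: "real^'n^'n \<Rightarrow> bool" where
  "pos_def M \<longleftrightarrow> transpose M = M \<and> (\<forall>x. x \<noteq> 0 \<longrightarrow> 0 < x \<bullet> (M *v x))"

definition stabilizable :: "real^'n^'n \<Rightarrow> real^'d^'n \<Rightarrow> bool" where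
  "stabilizable A B \<longleftrightarrow> (\<exists>K :: real^'n^'d. spectral_radius (A - B ** K) < 1)"

definition detectable :: "real^'n^'n \<Rightarrow> real^'n^'n \<Rightarrow> bool" where
  "detectable A Q \<longleftrightarrow> stabilizable (transpose A) Q"

definition lqr_assumptions ::
  "real^'n^'n \<Rightarrow> real^'d^'n \<Rightarrow> real^'n^'n \<Rightarrow> real^'d^'d \<Rightarrow> real^'n^'n \<Rightarrow> bool" where
  "lqr_assumptions A B Q R Qf \<longleftrightarrow>
     pos_semidef Q \<and> pos_semidef Qf \<and> pos_def R \<and> stabilizable A B \<and> detectable A Q"

definition riccati_solution ::
  "real^'n^'n \<Rightarrow> real^'d^'n \<Rightarrow> real^'n^'n \<Rightarrow> real^'d^'d \<Rightarrow> real^'n^'n \<Rightarrow> bool" where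
  "riccati_solution A B Q R P \<longleftrightarrow>
     pos_semidef P \<and>
     P = Q + transpose A ** P ** A
           - transpose A ** P ** B ** matrix_inv (R + transpose B ** P ** B)
               ** transpose B ** P ** A"

definition closed_loop ::
  "real^'n^'n \<Rightarrow> real^'d^'n \<Rightarrow> real^'d^'d \<Rightarrow> real^'n^'n \<Rightarrow> real^'n^'n" where
  "closed_loop A B R P =
     A - B ** matrix_inv (R + transpose B ** P ** B) ** transpose B ** P ** A"

primrec lqr_state ::
  "real^'n^'n \<Rightarrow> real^'d^'n \<Rightarrow> real^'n \<Rightarrow> (nat \<Rightarrow> real^'d) \<Rightarrow> (nat \<Rightarrow> real^'n) \<Rightarrow> nat \<Rightarrow> real^'n"
where
  "lqr_state A B x0 u w 0 = x0"
| "lqr_state A B x0 u w (Suc t) = A *v lqr_state A B x0 u w t + B *v u t + w t"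

definition lqr_cost ::
  "real^'n^'n \<Rightarrow> real^'d^'n \<Rightarrow> real^'n^'n \<Rightarrow> real^'d^'d \<Rightarrow> real^'n^'n \<Rightarrow> real^'n \<Rightarrow> nat
   \<Rightarrow> (nat \<Rightarrow> real^'d) \<Rightarrow> (nat \<Rightarrow> real^'n) \<Rightarrow> real"
where
  "lqr_cost A B Q R Qf x0 T u w =
     (let x = lqr_state A B x0 u w in
       (\<Sum>t<T. x t \<bullet> (Q *v x t) + u t \<bullet> (R *v u t)) + x T \<bullet> (Qf *v x T))"

(* Suprema and minima are taken in the extended reals, where they always exist.  Minimising
   over all control sequences u' is minimising over u'_0, ..., u'_(T-1), since lqr_cost does
   not look at later entries. *)
definition lqr_regret ::
  "real^'n^'n \<Rightarrow> real^'d^'n \<Rightarrow> real^'n^'n \<Rightarrow> real^'d^'d \<Rightarrow> real^'n^'n \<Rightarrow> real^'n \<Rightarrow> nat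
   \<Rightarrow> (nat \<Rightarrow> real^'d) \<Rightarrow> (nat \<Rightarrow> real^'n) \<Rightarrow> ereal"
where
  "lqr_regret A B Q R Qf x0 T u w =
     ereal (lqr_cost A B Q R Qf x0 T u w) - (INF u'. ereal (lqr_cost A B Q R Qf x0 T u' w))"

(* minimax \<Omega> k g m us ws is the value of the game from the point where the controls us and
   the disturbances ws have been played, with length ws = length us + k, and m disturbances
   are still to come: m times "min over the next control, sup over the next disturbance",
   then the min over the last k controls. *)
primrec minimax ::
  "'w set \<Rightarrow> nat \<Rightarrow> ('u list \<Rightarrow> 'w list \<Rightarrow> ereal) \<Rightarrow> nat \<Rightarrow> 'u list \<Rightarrow> 'w list \<Rightarrow> ereal"
where
  "minimax \<Omega> k g 0 us ws = (INF vs \<in> {vs. length vs = k}. g (us @ vs) ws)"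
| "minimax \<Omega> k g (Suc m) us ws = (INF u. SUP w\<in>\<Omega>. minimax \<Omega> k g m (us @ [u]) (ws @ [w]))"

definition opt_dynamic_regret ::
  "real^'n^'n \<Rightarrow> real^'d^'n \<Rightarrow> real^'n^'n \<Rightarrow> real^'d^'d \<Rightarrow> real^'n^'n \<Rightarrow> real^'n
   \<Rightarrow> (real^'n) set \<Rightarrow> nat \<Rightarrow> nat \<Rightarrow> ereal"
where
  "opt_dynamic_regret A B Q R Qf x0 \<Omega> k T =
     (SUP ws \<in> {ws. length ws = k \<and> set ws \<subseteq> \<Omega>}.
        minimax \<Omega> k (\<lambda>us ws. lqr_regret A B Q R Qf x0 T (\<lambda>t. us ! t) (\<lambda>t. ws ! t))
          (T - k) [] ws)"

end

(* Proof idea.  Completing the square with the Riccati solution P turns the cost with terminal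
   weight P into a constant plus sum_t e_t . G e_t, where e_t is the deviation of u_t from a feedback
   that uses the future disturbances through sum_j (F^T)^j P w_{t+j}.

   Upper bound: the controller that truncates this sum after the k known disturbances has deviations
   of size O(|F^k|).  Replacing P by Qf costs O(1): a nearly optimal trajectory is, by detectability,
   bounded at some time within a constant distance of T, and from there a stabilising feedback
   takes over.

   Lower bound: choosing every disturbance as e or - e, the averaged squared deviation at each of the
   first T - k steps is at least of order |F^k|^2, because u_t is chosen before w_{t+k} is known.

   The growth of F^k is controlled by its eigenvalues through polynomials that annihilate a vector. *)
theory Submission
  imports Defs "HOL-Computational_Algebra.Fundamental_Theorem_Algebra"
begin

subsection \<open>Growth of matrix powers\<close>

text \<open>For a terminal weight other than P the optimal control follows a time-varying Riccati
  recursion, whose convergence would have to be studied. This is avoided: the square is completed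
  with weight P alone, Qf enters only through cost comparisons that lose a constant, and the lower
  bound is free to take Qf = P. Minimisers are avoided in the same spirit: trajectories within 1 of
  the infimum suffice, because the upper bound has a summand 1 to spare.

  That \<rho>(F) < 1 is derived rather than assumed: P acts as a Lyapunov function for F, and
  detectability excludes the eigenvectors on which it fails to decrease. The number \<lambda> lies
  strictly above \<rho>(F), and this gap absorbs the polynomial factors by which the norm of F^k can
  exceed \<rho>(F)^k. Every constant depends on the system, x0 and the bound on the disturbances
  only, which is why all estimates come from geometric series or from absorbing a sum into
  itself.\<close>

definition poly_act :: "'a::field^'n^'n \<Rightarrow> 'a poly \<Rightarrow> 'a^'n \<Rightarrow> 'a^'n" where
  "poly_act M p v = fold_coeffs (\<lambda>a y. a *s v + M *v y) p 0"

lemma poly_act_0 [simp]: "poly_act M 0 v = 0"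
  by (simp add: poly_act_def)

lemma poly_act_pCons [simp]: "poly_act M (pCons a p) v = a *s v + M *v poly_act M p v"
  by (cases "a = 0 \<and> p = 0") (auto simp: poly_act_def)

lemma poly_act_add [simp]: "poly_act M (p + q) v = poly_act M p v + poly_act M q v"
  by (induction p q rule: poly_induct2)
    (simp_all add: matrix_vector_right_distrib vec.scale_left_distrib)

lemma poly_act_smult [simp]: "poly_act M (smult c p) v = c *s poly_act M p v"
  by (induction p) (simp_all add: vec.scale_right_distrib matrix_vector_mult_scaleR vector_scalar_commute)

lemma poly_act_sum [simp]: "poly_act M (\<Sum>i\<in>I. p i) v = (\<Sum>i\<in>I. poly_act M (p i) v)"
  by (induction I rule: infinite_finite_induct) simp_all

lemma poly_act_monom [simp]: "poly_act M (monom c i) v = c *s ((*v) M ^^ i) v"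
  by (induction i) (simp_all add: monom_0 monom_Suc vector_scalar_commute)

text \<open>Polynomials act on vectors as a commutative ring, so linear factors of an annihilating
  polynomial can be peeled off in any order, without a ring of matrices.\<close>

lemma poly_act_mult: "poly_act M (p * q) v = poly_act M p (poly_act M q v)"
  by (induction p) simp_all

lemma poly_act_add_right: "poly_act M p (v + w) = poly_act M p v + poly_act M p w"
  by (induction p) (simp_all add: matrix_vector_right_distrib vec.scale_right_distrib)

lemma poly_act_scale_right: "poly_act M p (c *s v) = c *s poly_act M p v"
  by (induction p)
    (simp_all add: vec.scale_right_distrib vector_scalar_commute vec.scale_left_commute)

lemma poly_act_sum_right: "poly_act M p (\<Sum>i\<in>I. v i) = (\<Sum>i\<in>I. poly_act M p (v i))"
proof (induction I rule: infinite_finite_induct)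
  case empty
  then show ?case using poly_act_scale_right[of M p 0 0] by simp
next
  case (infinite I)
  then show ?case using poly_act_scale_right[of M p 0 0] by simp
qed (simp_all add: poly_act_add_right)

lemma poly_act_eigenvector:
  assumes "M *v v = c *s v"
  shows "poly_act M p v = poly p c *s v"
  by (induction p) (simp_all add: vector_scalar_commute assms vec.scale_left_distrib mult.commute)

text \<open>The n + 1 vectors v, M v, ..., M^n v are dependent in dimension n. A polynomial for each
  single vector replaces the Cayley-Hamilton theorem.\<close>

lemma exists_annihilating_poly:
  fixes M :: "'a::field^'n^'n"
  shows "\<exists>p. p \<noteq> 0 \<and> poly_act M p v = 0"
proof -
  define f where "f i = ((*v) M ^^ i) v" for i
  define N where "N = CARD('n)"
  show ?thesis
  \<comment> \<open>Dependence is a notion for sets, so a repetition in the orbit is treated apart;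
    there X^i - X^j already annihilates v.\<close>
  proof (cases "inj_on f {..N}")
    case False
    then obtain i j where ij: "i \<noteq> j" "f i = f j" by (auto simp: inj_on_def)
    have "coeff (monom 1 i + smult (-1) (monom 1 j)) i \<noteq> (0::'a)" using ij by simp
    then have "monom 1 i + smult (-1) (monom 1 j) \<noteq> (0::'a poly)" by (metis coeff_0)
    moreover have "poly_act M (monom 1 i + smult (-1) (monom 1 j)) v = 0"
      using ij by (simp only: poly_act_add poly_act_smult poly_act_monom) (simp add: f_def)
    ultimately show ?thesis by blast
  next
    case True
    have "card (f ` {..N}) = Suc N" by (simp add: card_image True)
    then have "vec.dependent (f ` {..N})"
      using vec.independent_bound_general[of "f ` {..N}"] vec.dim_subset[of "f ` {..N}" UNIV]
      by (auto simp: N_def card_cart_basis)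
    then obtain u where u: "\<exists>y\<in>f ` {..N}. u y \<noteq> 0" "(\<Sum>y\<in>f ` {..N}. u y *s y) = 0"
      by (auto simp: vec.dependent_finite)
    define p where "p = (\<Sum>i\<le>N. monom (u (f i)) i)"
    obtain j where j: "j \<le> N" "u (f j) \<noteq> 0" using u(1) by auto
    have "coeff p j = (\<Sum>i\<le>N. if i = j then u (f i) else 0)"
      unfolding p_def coeff_sum coeff_monom by simp
    also have "\<dots> = u (f j)" using j by simp
    finally have "p \<noteq> 0" using j by auto
    moreover have "poly_act M p v = 0"
      using u(2) unfolding p_def sum.reindex[OF True] by (simp add: f_def)
    ultimately show ?thesis by blast
  qed
qed

text \<open>The outer form serves when M - c is injective and can be cancelled; the inner form
  passes to the vector M v - c v, which the smaller factor q annihilates.\<close>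

lemma poly_act_root_factor:
  "poly_act M ([:-c, 1:] * q) v = M *v poly_act M q v - c *s poly_act M q v"
  "poly_act M ([:-c, 1:] * q) v = poly_act M q (M *v v - c *s v)"
proof -
  show "poly_act M ([:-c, 1:] * q) v = M *v poly_act M q v - c *s poly_act M q v"
    unfolding poly_act_mult by simp
  have "poly_act M (q * [:-c, 1:]) v = poly_act M q (M *v v - c *s v)"
    unfolding poly_act_mult by simp
  then show "poly_act M ([:-c, 1:] * q) v = poly_act M q (M *v v - c *s v)"
    by (simp only: mult.commute)
qed

definition eigvals :: "complex^'n^'n \<Rightarrow> complex set" where
  "eigvals M = {c. \<exists>v. v \<noteq> 0 \<and> M *v v = c *s v}"

lemma complex_poly_root_factor:
  fixes p :: "complex poly"
  assumes "degree p = Suc n"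
  obtains c q where "p = [:-c, 1:] * q" "degree q = n" "q \<noteq> 0"
proof -
  have "\<not> constant (poly p)" using assms by (simp add: constant_degree)
  then obtain c where "poly p c = 0" using fundamental_theorem_of_algebra by blast
  then obtain q where q: "p = [:-c, 1:] * q" by (auto simp: poly_eq_0_iff_dvd)
  moreover have "q \<noteq> 0" using q assms by auto
  moreover have "degree p = Suc (degree q)"
    unfolding q by (subst degree_mult_eq) (use \<open>q \<noteq> 0\<close> in auto)
  ultimately show ?thesis using that assms by simp
qed

text \<open>Without eigenvalues every M - c is injective. Cancelling all linear factors of an
  annihilating polynomial then leaves a nonzero constant, so every vector would vanish.\<close>

lemma eigvals_nonempty:
  fixes M :: "complex^'n^'n"
  shows "eigvals M \<noteq> {}"
proof
  assume emp: "eigvals M = {}"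
  have inj: "v = 0" if "M *v v - c *s v = 0" for v c
    using that emp by (auto simp: eigvals_def)
  have *: "v = 0" if "degree p = n" "p \<noteq> 0" "poly_act M p v = 0" for n p v
    using that
  proof (induction n arbitrary: p)
    case 0
    then obtain a where "p = [:a:]" by (meson degree_eq_zeroE)
    then show ?case using 0 by simp
  next
    case (Suc n)
    then obtain c q where q: "p = [:-c, 1:] * q" "degree q = n" "q \<noteq> 0"
      using complex_poly_root_factor by metis
    have "poly_act M q v = 0"
      using Suc.prems(3) inj unfolding q(1) poly_act_root_factor(1) by blast
    then show ?case using Suc.IH q by blast
  qed
  \<comment> \<open>The vector with all entries 1 serves as a nonzero vector.\<close>
  have "(1 :: complex^'n) = 0"
    using * exists_annihilating_poly by blast
  then show False by simp
qed

text \<open>The product of annihilators of the basis vectors annihilates everything, so each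
  eigenvalue is among its finitely many roots.\<close>

lemma finite_eigvals:
  fixes M :: "complex^'n^'n"
  shows "finite (eigvals M)"
proof -
  have "\<forall>i. \<exists>p. p \<noteq> 0 \<and> poly_act M p (axis i 1) = 0"
    using exists_annihilating_poly by blast
  then obtain p where p: "\<And>i. p i \<noteq> 0 \<and> poly_act M (p i) (axis i 1) = 0"
    by metis
  define r where "r = (\<Prod>i\<in>UNIV. p i)"
  have "r \<noteq> 0" unfolding r_def using p by simp
  have ax: "poly_act M r (axis i 1) = 0" for i
  proof -
    have "r = (\<Prod>j\<in>UNIV - {i}. p j) * p i"
      unfolding r_def by (subst prod.remove[of _ i]) (auto simp: mult.commute)
    then show ?thesis using p poly_act_scale_right[of M _ 0 0] by (simp add: poly_act_mult)
  qed
  have zero: "poly_act M r v = 0" for v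
  proof -
    have "poly_act M r v = poly_act M r (\<Sum>i\<in>UNIV. v $ i *s axis i 1)"
      by (simp add: basis_expansion)
    also have "\<dots> = 0" by (simp add: poly_act_sum_right poly_act_scale_right ax)
    finally show ?thesis .
  qed
  have "eigvals M \<subseteq> {c. poly r c = 0}"
  proof
    fix c assume "c \<in> eigvals M"
    then obtain v where v: "v \<noteq> 0" "M *v v = c *s v" by (auto simp: eigvals_def)
    from poly_act_eigenvector[OF v(2), of r] have "poly r c *s v = 0" by (simp add: zero)
    then show "c \<in> {c. poly r c = 0}" using v(1) by simp
  qed
  then show ?thesis using poly_roots_finite[OF \<open>r \<noteq> 0\<close>] finite_subset by blast
qed

lemma norm_vector_scalar_mult: "norm (c *s (v :: 'a::real_normed_field^'n)) = norm c * norm v"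
  by (simp add: norm_vec_def norm_mult L2_set_right_distrib)

text \<open>The bound D satisfies a D + C \<le> D r. Because a < r strictly, a forcing term growing
  like r^k costs only a constant and no factor k.\<close>

lemma linear_recursion_bound:
  fixes x :: "nat \<Rightarrow> real"
  assumes "\<And>k. x (Suc k) \<le> a * x k + C * r ^ k" "0 \<le> a" "a < r"
  shows "x k \<le> max (x 0) (C / (r - a)) * r ^ k"
proof (induction k)
  case (Suc k)
  define D where "D = max (x 0) (C / (r - a))"
  have "C \<le> D * (r - a)" using assms(3) by (simp add: D_def pos_divide_le_eq[symmetric])
  then have "a * D + C \<le> D * r" by (simp add: algebra_simps)
  then have le: "(a * D + C) * r ^ k \<le> D * r * r ^ k"
    using assms(2,3) by (intro mult_right_mono) auto
  have "a * x k \<le> a * (D * r ^ k)"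
    using Suc assms(2) unfolding D_def by (rule mult_left_mono)
  then have "x (Suc k) \<le> a * (D * r ^ k) + C * r ^ k" using assms(1)[of k] by linarith
  also have "\<dots> \<le> D * r ^ Suc k" using le by (simp add: algebra_simps)
  finally show ?case by (simp add: D_def)
qed simp

text \<open>This replaces the Jordan form. Induction on the degree of the annihilator: a root that
  is no eigenvalue is cancelled; at an eigenvalue c the orbit of v obeys a scalar recursion with
  factor c, driven by the orbit of M v - c v, which has an annihilator of smaller degree.\<close>

lemma complex_orbit_bound:
  fixes M :: "complex^'n^'n"
  assumes ev: "\<And>c. c \<in> eigvals M \<Longrightarrow> cmod c < r" and "degree p = n" "p \<noteq> 0" "poly_act M p v = 0"
  shows "\<exists>C. \<forall>k. norm (((*v) M ^^ k) v) \<le> C * r ^ k"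
  using assms(2-)
proof (induction n arbitrary: p v)
  case 0
  then obtain a where a: "p = [:a:]" by (meson degree_eq_zeroE)
  then have "v = 0" using 0 by simp
  moreover have "((*v) M ^^ k) 0 = 0" for k by (induction k) auto
  ultimately show ?case by (intro exI[of _ 0]) simp
next
  case (Suc n)
  then obtain c q where q: "p = [:-c, 1:] * q" "degree q = n" "q \<noteq> 0"
    using complex_poly_root_factor by metis
  show ?case
  proof (cases "c \<in> eigvals M")
    case False
    then have "poly_act M q v = 0"
      using Suc.prems(3) unfolding q(1) poly_act_root_factor(1) by (auto simp: eigvals_def)
    then show ?thesis using Suc.IH q by blast
  next
    case True
    define y where "y = M *v v - c *s v"
    have "poly_act M q y = 0"
      using Suc.prems(3) unfolding q(1) poly_act_root_factor(2) y_def .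
    then obtain C where C: "norm (((*v) M ^^ k) y) \<le> C * r ^ k" for k using Suc.IH q by blast
    have step: "((*v) M ^^ Suc k) v = c *s ((*v) M ^^ k) v + ((*v) M ^^ k) y" for k
      by (induction k)
        (simp_all add: y_def matrix_vector_right_distrib vector_scalar_commute)
    have "norm (((*v) M ^^ Suc k) v) \<le> cmod c * norm (((*v) M ^^ k) v) + C * r ^ k" for k
      unfolding step using C[of k] norm_triangle_ineq[of "c *s ((*v) M ^^ k) v"]
      by (smt (verit) norm_vector_scalar_mult)
    then show ?thesis
      using linear_recursion_bound[of "\<lambda>k. norm (((*v) M ^^ k) v)" "cmod c" C r] ev[OF True] by auto
  qed
qed

section \<open>Real matrices: spectral radius and growth of powers\<close>

definition cvec :: "real^'n \<Rightarrow> complex^'n" where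
  "cvec x = (\<chi> i. complex_of_real (x $ i))"

lemma norm_cvec: "norm (cvec x) = norm x"
  by (simp add: cvec_def norm_vec_def)

lemma map_matrix_cvec: "map_matrix complex_of_real M *v cvec x = cvec (M *v x)"
  by (simp add: cvec_def matrix_vector_mult_def map_matrix_def vec_eq_iff)

lemma eigenvalues_eigvals: "eigenvalues M = eigvals (map_matrix complex_of_real M)"
  by (simp add: eigenvalues_def eigvals_def)

text \<open>\<open>Max\<close> says something only about finite nonempty sets, so both facts about
  complex eigenvalues enter here.\<close>

lemma spectral_radius_less_iff: "spectral_radius M < r \<longleftrightarrow> (\<forall>c\<in>eigenvalues M. cmod c < r)"
  unfolding spectral_radius_def eigenvalues_eigvals
  using finite_eigvals eigvals_nonempty by (subst Max_less_iff) auto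

lemma spectral_radius_nonneg: "0 \<le> spectral_radius M"
  using spectral_radius_less_iff[of M 0] eigvals_nonempty eigenvalues_eigvals
  by (metis all_not_in_conv norm_not_less_zero not_le)

lemma mat_pow_funpow: "mat_pow M k *v x = ((*v) M ^^ k) x"
  by (induction k) (simp_all add: matrix_vector_mul_assoc[symmetric])

lemma mat_pow_bound:
  fixes M :: "real^'n^'n"
  assumes "spectral_radius M < r"
  shows "\<exists>C>0. \<forall>k x. norm (mat_pow M k *v x) \<le> C * r ^ k * norm x"
proof -
  define M' where "M' = map_matrix complex_of_real M"
  have r: "r > 0" using assms spectral_radius_nonneg[of M] by linarith
  have ev: "c \<in> eigvals M' \<Longrightarrow> cmod c < r" for c
    using assms by (simp add: spectral_radius_less_iff eigenvalues_eigvals M'_def)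
  have pw: "((*v) M' ^^ k) (cvec x) = cvec (((*v) M ^^ k) x)" for k x
    by (induction k) (simp_all add: M'_def map_matrix_cvec)
  have "\<exists>C. \<forall>k. norm (((*v) M ^^ k) x) \<le> C * r ^ k" for x
    using complex_orbit_bound[OF ev] exists_annihilating_poly[of M' "cvec x"] pw
    by (metis norm_cvec)
  then obtain C where C: "\<And>x k. norm (((*v) M ^^ k) x) \<le> C x * r ^ k" by metis
  \<comment> \<open>So far the constant depends on the vector; summing over the basis makes it
    uniform, and the added 1 makes it positive.\<close>
  define D where "D = (\<Sum>i\<in>UNIV. \<bar>C (axis i 1)\<bar>) + 1"
  have "norm (mat_pow M k *v x) \<le> D * r ^ k * norm x" for k x
  proof -
    have "mat_pow M k *v x = (\<Sum>i\<in>UNIV. x $ i *\<^sub>R (mat_pow M k *v axis i 1))"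
      by (subst basis_expansion[of x, symmetric])
        (simp add: vec.sum matrix_vector_mult_scaleR scalar_mult_eq_scaleR del: basis_expansion)
    also have "norm \<dots> \<le> (\<Sum>i\<in>UNIV. norm x * (\<bar>C (axis i 1)\<bar> * r ^ k))"
    proof (rule sum_norm_le)
      fix i
      have "norm (mat_pow M k *v axis i 1) \<le> \<bar>C (axis i 1)\<bar> * r ^ k"
        using C[of k "axis i 1"] r unfolding mat_pow_funpow
        by (smt (verit) mult_right_mono zero_less_power)
      then show "norm (x $ i *\<^sub>R (mat_pow M k *v axis i 1)) \<le> norm x * (\<bar>C (axis i 1)\<bar> * r ^ k)"
        using component_le_norm_cart[of x i] by (auto intro!: mult_mono)
    qed
    also have "\<dots> = (\<Sum>i\<in>UNIV. \<bar>C (axis i 1)\<bar>) * (r ^ k * norm x)"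
      by (simp add: sum_distrib_left sum_distrib_right mult_ac)
    also have "\<dots> \<le> D * (r ^ k * norm x)"
      using r unfolding D_def by (intro mult_right_mono) auto
    finally show ?thesis by (simp add: mult.assoc)
  qed
  moreover have "D > 0" unfolding D_def by (simp add: add_nonneg_pos sum_nonneg)
  ultimately show ?thesis by blast
qed

subsection \<open>Quadratic forms and stable recursions\<close>

lemma inner_transpose:
  fixes M :: "real^'n^'m"
  shows "(transpose M *v x) \<bullet> y = x \<bullet> (M *v y)" "y \<bullet> (transpose M *v x) = (M *v y) \<bullet> x"
proof -
  show *: "(transpose M *v x) \<bullet> y = x \<bullet> (M *v y)" for x y
    by (simp add: dot_lmul_matrix vector_transpose_matrix[symmetric] del: vector_transpose_matrix)
  show "y \<bullet> (transpose M *v x) = (M *v y) \<bullet> x"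
    using *[of x y] by (simp add: inner_commute)
qed

lemma psd_form_sym:
  assumes "transpose M = M"
  shows "x \<bullet> (M *v y) = (M *v x) \<bullet> (y::real^'n)"
  using inner_transpose(1)[of M x y] unfolding assms by simp

lemma matrix_bound:
  fixes M :: "real^'n^'m"
  obtains c where "c > 0" "\<And>x. norm (M *v x) \<le> c * norm x"
  using linear_bounded_pos[OF matrix_vector_mul_linear[of M]] by blast

text \<open>The form is evaluated at x - (1/c) M x, with c a bound for the norm of M. This is how
  vanishing or small state cost controls the vector Q x itself.\<close>

lemma psd_norm_le:
  fixes M :: "real^'n^'n"
  assumes "pos_semidef M"
  obtains c where "c > 0" "\<And>x. (norm (M *v x))\<^sup>2 \<le> c * (x \<bullet> (M *v x))"
proof -
  obtain c where c: "c > 0" "\<And>x. norm (M *v x) \<le> c * norm x" using matrix_bound by blast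
  have sym: "transpose M = M" and nonneg: "0 \<le> x \<bullet> (M *v x)" for x
    using assms by (auto simp: pos_semidef_def)
  have "(norm (M *v x))\<^sup>2 \<le> c * (x \<bullet> (M *v x))" for x
  proof -
    define y where "y = M *v x"
    have "y \<bullet> (M *v y) \<le> norm y * (c * norm y)"
      using norm_cauchy_schwarz[of y "M *v y"] mult_left_mono[OF c(2)[of y] norm_ge_zero[of y]]
      by linarith
    then have y: "y \<bullet> (M *v y) \<le> c * (norm y)\<^sup>2" by (simp add: power2_eq_square mult_ac)
    have "0 \<le> (x - (1/c) *\<^sub>R y) \<bullet> (M *v (x - (1/c) *\<^sub>R y))" by (rule nonneg)
    also have "\<dots> = x \<bullet> y - 2 * (y \<bullet> y) / c + (y \<bullet> (M *v y)) / c\<^sup>2"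
      using psd_form_sym[OF sym, of x y] 
      by (simp add: matrix_vector_mult_diff_distrib matrix_vector_mult_scaleR inner_diff_left
          inner_diff_right y_def[symmetric] power2_eq_square inner_commute
          diff_divide_distrib)
    also have "(y \<bullet> (M *v y)) / c\<^sup>2 \<le> (c * (norm y)\<^sup>2) / c\<^sup>2"
      using y c(1) by (intro divide_right_mono) auto
    also have "\<dots> = (norm y)\<^sup>2 / c" using c(1) by (simp add: power2_eq_square)
    finally have "(norm y)\<^sup>2 / c \<le> x \<bullet> y" by (simp add: power2_norm_eq_inner)
    then show ?thesis using c(1) by (simp add: y_def pos_divide_le_eq mult.commute)
  qed
  with c(1) show ?thesis using that by blast
qed

lemma invertible_injective:
  fixes M :: "real^'n^'n"
  assumes "\<And>x. M *v x = 0 \<Longrightarrow> x = 0"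
  shows "invertible M"
  using assms matrix_left_invertible_ker[of M] invertible_left_inverse by blast

lemma matrix_inv_vector:
  fixes M :: "real^'n^'n"
  assumes "invertible M"
  shows "M *v (matrix_inv M *v x) = x" "matrix_inv M *v (M *v x) = x"
proof -
  have "M ** matrix_inv M = mat 1 \<and> matrix_inv M ** M = mat 1"
    using assms unfolding invertible_def matrix_inv_def by (rule someI_ex)
  then show "M *v (matrix_inv M *v x) = x" "matrix_inv M *v (M *v x) = x"
    by (simp_all add: matrix_vector_mul_assoc)
qed

lemma pos_def_invertible:
  fixes M :: "real^'n^'n"
  assumes "pos_def M"
  shows "invertible M"
  using assms by (intro invertible_injective) (force simp: pos_def_def)

lemma pos_def_imp_pos_semidef: "pos_def M \<Longrightarrow> pos_semidef M"
  by (auto simp: pos_def_def pos_semidef_def) (metis inner_zero_left less_eq_real_def)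

text \<open>Invertibility bounds the norm of x by that of M x, and the semidefinite estimate does
  the rest; no least eigenvalue has to be found.\<close>

lemma pos_def_norm_le:
  fixes M :: "real^'n^'n"
  assumes "pos_def M"
  obtains c where "c > 0" "\<And>x. (norm x)\<^sup>2 \<le> c * (x \<bullet> (M *v x))"
proof -
  obtain c where c: "c > 0" "\<And>x. (norm (M *v x))\<^sup>2 \<le> c * (x \<bullet> (M *v x))"
    using psd_norm_le[OF pos_def_imp_pos_semidef[OF assms]] by blast
  obtain d where d: "d > 0" "\<And>x. norm (matrix_inv M *v x) \<le> d * norm x" using matrix_bound by blast
  have "(norm x)\<^sup>2 \<le> (d\<^sup>2 * c) * (x \<bullet> (M *v x))" for x
  proof -
    have "norm x \<le> d * norm (M *v x)"
      using d(2)[of "M *v x"] by (simp add: matrix_inv_vector pos_def_invertible[OF assms])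
    then have "(norm x)\<^sup>2 \<le> d\<^sup>2 * (norm (M *v x))\<^sup>2"
      unfolding power_mult_distrib[symmetric] by (rule power_mono) simp
    also have "\<dots> \<le> d\<^sup>2 * (c * (x \<bullet> (M *v x)))" by (intro mult_left_mono c) simp
    finally show ?thesis by (simp add: mult.assoc)
  qed
  then show ?thesis using that[of "d\<^sup>2 * c"] c d by simp
qed

lemma mat_pow_Suc_right: "mat_pow M (Suc k) *v x = mat_pow M k *v (M *v x)"
  unfolding mat_pow_funpow funpow_Suc_right by simp

lemma mat_pow_add: "mat_pow M (i + j) *v x = mat_pow M i *v (mat_pow M j *v x)"
  unfolding mat_pow_funpow by (simp add: funpow_add)

lemma inner_mat_pow_transpose: "(mat_pow (transpose M) k *v x) \<bullet> y = x \<bullet> (mat_pow M k *v y)"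
proof (induction k arbitrary: x y)
  case (Suc k)
  have "(mat_pow (transpose M) (Suc k) *v x) \<bullet> y = (mat_pow (transpose M) k *v x) \<bullet> (M *v y)"
    by (simp only: mat_pow.simps matrix_vector_mul_assoc[symmetric] inner_transpose)
  also have "\<dots> = x \<bullet> (mat_pow M (Suc k) *v y)" unfolding mat_pow_Suc_right Suc ..
  finally show ?case .
qed simp

lemma norm_mat_pow_transpose_le:
  assumes "\<And>x. norm (mat_pow M k *v x) \<le> c * norm x"
  shows "norm (mat_pow (transpose M) k *v x) \<le> c * norm x"
proof -
  define y where "y = mat_pow (transpose M) k *v x"
  have "(norm y)\<^sup>2 = x \<bullet> (mat_pow M k *v y)"
    unfolding power2_norm_eq_inner using inner_mat_pow_transpose by (simp add: y_def)
  also have "\<dots> \<le> norm x * (c * norm y)"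
    using norm_cauchy_schwarz[of x "mat_pow M k *v y"] mult_left_mono[OF assms[of y] norm_ge_zero[of x]]
    by linarith
  finally have "norm y * norm y \<le> (c * norm x) * norm y" by (simp add: power2_eq_square mult_ac)
  moreover have "0 \<le> c * norm x" using assms[of x] norm_ge_zero order_trans by blast
  ultimately have "norm y \<le> c * norm x"
    by (cases "norm y = 0") auto
  then show ?thesis by (simp add: y_def)
qed

lemma norm_le_spectral_norm: "norm (M *v x) \<le> spectral_norm M * norm x"
  unfolding spectral_norm_def by (intro onorm matrix_vector_mul_bounded_linear)

lemma spectral_norm_le: "(\<And>x. norm (M *v x) \<le> b * norm x) \<Longrightarrow> spectral_norm M \<le> b"
  unfolding spectral_norm_def by (rule onorm_le)

lemma spectral_norm_nonneg: "0 \<le> spectral_norm M"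
  unfolding spectral_norm_def by (rule onorm_pos_le[OF matrix_vector_mul_bounded_linear])

text \<open>The supremum of the norms of M^k x divided by r^k is an equivalent norm in which M
  contracts by r in a single step, so that forced recursions can be estimated step by step.\<close>

lemma adapted_norm:
  fixes M :: "real^'n^'n"
  assumes r: "0 < r" and "\<And>k x. norm (mat_pow M k *v x) \<le> C * r ^ k * norm x"
  obtains N where "\<And>x. norm x \<le> N x" "\<And>x. N x \<le> C * norm x"
    "\<And>x y. N (x + y) \<le> N x + N y" "\<And>x. N (M *v x) \<le> r * N x"
proof -
  define N where "N x = (SUP k. norm (mat_pow M k *v x) / r ^ k)" for x
  have le: "norm (mat_pow M k *v x) / r ^ k \<le> C * norm x" for k x
    using assms(2)[of k x] r by (simp add: pos_divide_le_eq mult_ac)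
  have bdd: "bdd_above (range (\<lambda>k. norm (mat_pow M k *v x) / r ^ k))" for x
    using le by (intro bdd_aboveI2) auto
  have N: "norm (mat_pow M k *v x) / r ^ k \<le> N x" for k x
    unfolding N_def by (intro cSUP_upper bdd) auto
  have "norm x \<le> N x" for x using N[of 0 x] by simp
  moreover have "N x \<le> C * norm x" for x unfolding N_def by (intro cSUP_least le) auto
  moreover have "N (x + y) \<le> N x + N y" for x y
  proof -
    have "norm (mat_pow M k *v (x + y)) / r ^ k \<le> N x + N y" for k
    proof -
      have "norm (mat_pow M k *v (x + y)) / r ^ k
          \<le> (norm (mat_pow M k *v x) + norm (mat_pow M k *v y)) / r ^ k"
        using r by (intro divide_right_mono) (auto simp: matrix_vector_right_distrib norm_triangle_ineq)
      then show ?thesis using N[of k x] N[of k y] by (simp add: add_divide_distrib)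
    qed
    then show ?thesis unfolding N_def[of "x + y"] by (intro cSUP_least) auto
  qed
  moreover have "N (M *v x) \<le> r * N x" for x
  proof -
    have "norm (mat_pow M k *v (M *v x)) / r ^ k \<le> r * N x" for k
    proof -
      have "norm (mat_pow M k *v (M *v x)) / r ^ k = r * (norm (mat_pow M (Suc k) *v x) / r ^ Suc k)"
        using r unfolding mat_pow_Suc_right by simp
      also have "\<dots> \<le> r * N x" using N[of "Suc k" x] r by (intro mult_left_mono) auto
      finally show ?thesis .
    qed
    then show ?thesis unfolding N_def[of "M *v x"] by (intro cSUP_least) auto
  qed
  ultimately show ?thesis using that by blast
qed

text \<open>Convexity of the square with weights r and 1 - r. The coefficient of a^2 remains r < 1,
  which allows sums of squares to be absorbed.\<close>

lemma convex_square_le: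
  fixes a b r :: real
  assumes "0 \<le> r" "r < 1"
  shows "(r * a + b)\<^sup>2 \<le> r * a\<^sup>2 + b\<^sup>2 / (1 - r)"
proof -
  have "r * a\<^sup>2 + b\<^sup>2 / (1 - r) - (r * a + b)\<^sup>2 = r / (1 - r) * ((1 - r) * a - b)\<^sup>2"
    using assms by (simp add: field_simps power2_eq_square)
  moreover have "0 \<le> r / (1 - r) * ((1 - r) * a - b)\<^sup>2" using assms by simp
  ultimately show ?thesis by linarith
qed

locale stable_matrix =
  fixes M :: "real^'n^'n" and C r :: real
  assumes C: "0 < C" and r: "0 < r" "r < 1"
    and pow: "norm (mat_pow M k *v x) \<le> C * r ^ k * norm x"
begin

text \<open>In the adapted norm one step is at worst s -> r s + C d, with fixed point C d / (1 -
  r).\<close>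

lemma orbit_bound:
  assumes "0 \<le> d" and y: "\<And>t. t < T \<Longrightarrow> norm (y (Suc t) - M *v y t) \<le> d"
  shows "norm (y T) \<le> C * norm (y 0) + C * d / (1 - r)"
proof -
  obtain N where N: "\<And>x. norm x \<le> N x" "\<And>x. N x \<le> C * norm x"
    "\<And>x y. N (x + y) \<le> N x + N y" "\<And>x. N (M *v x) \<le> r * N x"
    using adapted_norm[OF r(1) pow] by blast
  have "N (y t) \<le> C * norm (y 0) + C * d / (1 - r)" if "t \<le> T" for t
    using that
  proof (induction t)
    case 0
    show ?case using N(2)[of "y 0"] C r \<open>0 \<le> d\<close> by (smt (verit) divide_nonneg_nonneg mult_nonneg_nonneg)
  next
    case (Suc t)
    define e where "e = y (Suc t) - M *v y t"
    have "N (y (Suc t)) \<le> N (M *v y t) + N e" using N(3)[of "M *v y t" e] by (simp add: e_def)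
    also have "\<dots> \<le> r * N (y t) + C * d"
      using N(4)[of "y t"] N(2)[of e] mult_left_mono[of "norm e" d C] y[of t] Suc.prems C
      unfolding e_def by linarith
    also have "\<dots> \<le> r * (C * norm (y 0) + C * d / (1 - r)) + C * d"
      using Suc r by simp
    also have "\<dots> = r * (C * norm (y 0)) + C * d / (1 - r)" using r by (simp add: field_simps)
    also have "\<dots> \<le> C * norm (y 0) + C * d / (1 - r)"
      using r C by (simp add: mult_left_le_one_le)
    finally show ?case .
  qed
  from this[of T] N(1)[of "y T"] show ?thesis by simp
qed

text \<open>The square-summable counterpart of \<open>orbit_bound\<close>: summing the one-step
  estimate, r times the sum is moved to the left. It is suited to forcing terms known only through a
  total cost.\<close>

lemma orbit_square_sum_bound:
  assumes y: "\<And>t. t < T \<Longrightarrow> norm (y (Suc t) - M *v y t) \<le> d t"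
  shows "(\<Sum>t\<le>T. (norm (y t))\<^sup>2) \<le> C\<^sup>2 / (1 - r) * (norm (y 0))\<^sup>2 + C\<^sup>2 / (1 - r)\<^sup>2 * (\<Sum>t<T. (d t)\<^sup>2)"
proof -
  obtain N where N: "\<And>x. norm x \<le> N x" "\<And>x. N x \<le> C * norm x"
    "\<And>x y. N (x + y) \<le> N x + N y" "\<And>x. N (M *v x) \<le> r * N x"
    using adapted_norm[OF r(1) pow] by blast
  have N0: "0 \<le> N x" for x using N(1)[of x] norm_ge_zero[of x] by linarith
  have step: "(N (y (Suc t)))\<^sup>2 \<le> r * (N (y t))\<^sup>2 + C\<^sup>2 / (1 - r) * (d t)\<^sup>2" if "t < T" for t
  proof -
    define e where "e = y (Suc t) - M *v y t"
    have "N (y (Suc t)) \<le> N (M *v y t) + N e" using N(3)[of "M *v y t" e] by (simp add: e_def)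
    also have "\<dots> \<le> r * N (y t) + C * d t"
      using N(4)[of "y t"] N(2)[of e] mult_left_mono[of "norm e" "d t" C] y[OF that] C
      unfolding e_def by linarith
    finally have "(N (y (Suc t)))\<^sup>2 \<le> (r * N (y t) + C * d t)\<^sup>2"
      using N0 by (intro power_mono) auto
    also have "\<dots> \<le> r * (N (y t))\<^sup>2 + (C * d t)\<^sup>2 / (1 - r)"
      using r by (intro convex_square_le) auto
    finally show ?thesis by (simp add: power_mult_distrib)
  qed
  have "(\<Sum>t\<le>T. (N (y t))\<^sup>2) = (N (y 0))\<^sup>2 + (\<Sum>t<T. (N (y (Suc t)))\<^sup>2)"
    by (rule sum.atMost_shift)
  also have "(\<Sum>t<T. (N (y (Suc t)))\<^sup>2) \<le> (\<Sum>t<T. r * (N (y t))\<^sup>2 + C\<^sup>2 / (1 - r) * (d t)\<^sup>2)"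
    by (intro sum_mono step) auto
  also have "\<dots> = r * (\<Sum>t<T. (N (y t))\<^sup>2) + C\<^sup>2 / (1 - r) * (\<Sum>t<T. (d t)\<^sup>2)"
    by (simp add: sum.distrib sum_distrib_left)
  finally have le: "(\<Sum>t\<le>T. (N (y t))\<^sup>2)
      \<le> (N (y 0))\<^sup>2 + (r * (\<Sum>t<T. (N (y t))\<^sup>2) + C\<^sup>2 / (1 - r) * (\<Sum>t<T. (d t)\<^sup>2))"
    by simp
  have "r * (\<Sum>t<T. (N (y t))\<^sup>2) \<le> r * (\<Sum>t\<le>T. (N (y t))\<^sup>2)"
    using r by (intro mult_left_mono sum_mono2) auto
  with le have "(1 - r) * (\<Sum>t\<le>T. (N (y t))\<^sup>2) \<le> (N (y 0))\<^sup>2 + C\<^sup>2 / (1 - r) * (\<Sum>t<T. (d t)\<^sup>2)"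
    unfolding left_diff_distrib by linarith
  moreover have "(N (y 0))\<^sup>2 \<le> C\<^sup>2 * (norm (y 0))\<^sup>2"
    using power_mono[OF N(2)[of "y 0"] N0, of 2] by (simp add: power_mult_distrib)
  ultimately have "(\<Sum>t\<le>T. (N (y t))\<^sup>2) * (1 - r) \<le> C\<^sup>2 * (norm (y 0))\<^sup>2 + C\<^sup>2 / (1 - r) * (\<Sum>t<T. (d t)\<^sup>2)"
    by (simp add: mult.commute)
  then have "(\<Sum>t\<le>T. (N (y t))\<^sup>2) \<le> (C\<^sup>2 * (norm (y 0))\<^sup>2 + C\<^sup>2 / (1 - r) * (\<Sum>t<T. (d t)\<^sup>2)) / (1 - r)"
    using r by (subst pos_le_divide_eq) auto
  also have "\<dots> = C\<^sup>2 / (1 - r) * (norm (y 0))\<^sup>2 + C\<^sup>2 / (1 - r)\<^sup>2 * (\<Sum>t<T. (d t)\<^sup>2)"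
    by (simp add: add_divide_distrib power2_eq_square)
  finally have "(\<Sum>t\<le>T. (N (y t))\<^sup>2) \<le> \<dots>" .
  moreover have "(\<Sum>t\<le>T. (norm (y t))\<^sup>2) \<le> (\<Sum>t\<le>T. (N (y t))\<^sup>2)"
    by (intro sum_mono power_mono N) auto
  ultimately show ?thesis by linarith
qed

end

lemma stable_matrix_spectral_radius:
  fixes M :: "real^'n^'n"
  assumes "spectral_radius M < 1"
  obtains C r where "stable_matrix M C r"
proof -
  define r where "r = (1 + spectral_radius M) / 2"
  have r: "spectral_radius M < r" "0 < r" "r < 1"
    using assms spectral_radius_nonneg[of M] by (auto simp: r_def)
  from mat_pow_bound[OF r(1)] obtain C where
    "C > 0" "\<And>k x. norm (mat_pow M k *v x) \<le> C * r ^ k * norm x" by blast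
  then show ?thesis using that[of C r] r by (simp add: stable_matrix_def)
qed

lemma stable_matrix_transpose:
  assumes "stable_matrix M C r"
  shows "stable_matrix (transpose M) C r"
  using assms norm_mat_pow_transpose_le[of M] unfolding stable_matrix_def by blast

(* x + i y is an eigenvector for a + i b. *)
lemma stable_matrix_real_eigenpair:
  fixes M :: "real^'n^'n"
  assumes "stable_matrix M C r"
    and xy: "M *v x = a *\<^sub>R x - b *\<^sub>R y" "M *v y = a *\<^sub>R y + b *\<^sub>R x" and ab: "1 \<le> a\<^sup>2 + b\<^sup>2"
  shows "x = 0 \<and> y = 0"
proof -
  interpret stable_matrix M C r by fact
  define S where "S = (norm x)\<^sup>2 + (norm y)\<^sup>2"
  \<comment> \<open>M multiplies the joint squared norm of x and y by a^2 + b^2 \<ge> 1, so it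
    cannot decay along the orbit, whereas stability forces it to 0.\<close>
  have inv: "S \<le> (norm (mat_pow M k *v x))\<^sup>2 + (norm (mat_pow M k *v y))\<^sup>2" for k
    unfolding S_def
    using xy
  proof (induction k arbitrary: x y)
    case (Suc k)
    let ?x = "a *\<^sub>R x - b *\<^sub>R y" and ?y = "a *\<^sub>R y + b *\<^sub>R x"
    have "(norm ?x)\<^sup>2 + (norm ?y)\<^sup>2 = (a\<^sup>2 + b\<^sup>2) * ((norm x)\<^sup>2 + (norm y)\<^sup>2)"
      unfolding power2_norm_eq_inner
      by (simp add: inner_diff_left inner_diff_right inner_add_left inner_add_right inner_commute
          algebra_simps power2_eq_square)
    moreover have "\<dots> \<ge> 1 * ((norm x)\<^sup>2 + (norm y)\<^sup>2)" using ab by (intro mult_right_mono) auto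
    moreover have "(norm ?x)\<^sup>2 + (norm ?y)\<^sup>2 \<le> (norm (mat_pow M k *v ?x))\<^sup>2 + (norm (mat_pow M k *v ?y))\<^sup>2"
      using Suc.prems
      by (intro Suc.IH) (simp_all add: matrix_vector_mult_diff_distrib matrix_vector_right_distrib
          matrix_vector_mult_scaleR)
    ultimately show ?case using Suc.prems unfolding mat_pow_Suc_right by simp
  qed simp
  have "S \<le> (C\<^sup>2 * S) * (r\<^sup>2) ^ k" for k
  proof -
    have "(norm (mat_pow M k *v z))\<^sup>2 \<le> (C * r ^ k * norm z)\<^sup>2" for z by (intro power_mono pow) auto
    then have "S \<le> (C * r ^ k * norm x)\<^sup>2 + (C * r ^ k * norm y)\<^sup>2" using inv[of k] by (smt (verit))
    then show ?thesis by (simp add: S_def power_mult_distrib algebra_simps power_mult[symmetric])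
  qed
  moreover have "(\<lambda>k. (C\<^sup>2 * S) * (r\<^sup>2) ^ k) \<longlonglongrightarrow> (C\<^sup>2 * S) * 0"
    using r by (intro tendsto_mult_left LIMSEQ_power_zero) (auto simp: power_less_one_iff abs_square_less_1)
  ultimately have "S \<le> 0" by (intro LIMSEQ_le_const[of _ "0::real"]) auto
  then show ?thesis by (smt (verit) S_def norm_le_zero_iff power_eq_0_iff zero_le_power2 norm_eq_zero)
qed

subsection \<open>The Riccati equation and completion of squares\<close>

lemma lqr_state_cong:
  "(\<And>i. i < t \<Longrightarrow> u i = u' i \<and> w i = w' i) \<Longrightarrow> lqr_state A B x0 u w t = lqr_state A B x0 u' w' t"
  by (induction t) auto

lemma sum_lessThan_split: "s \<le> T \<Longrightarrow> (\<Sum>t<T. f t) = (\<Sum>t<s. f t) + (\<Sum>j<T - s. f (s + j :: nat))"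
  for f :: "nat \<Rightarrow> 'a::comm_monoid_add"
  by (simp only: lessThan_atLeast0 sum.atLeastLessThan_concat[symmetric, of 0 s T])
    (simp add: sum.atLeastLessThan_shift_0[of _ s T])

text \<open>W bounds the disturbances. As a parameter it belongs, with the system and x0, to the
  data on which the constants obtained below may depend.\<close>

locale lqr =
  fixes A :: "real^'n^'n" and B :: "real^'d^'n" and Q :: "real^'n^'n" and R :: "real^'d^'d"
    and Qf P :: "real^'n^'n" and x0 :: "real^'n" and W :: real
  assumes lqr: "lqr_assumptions A B Q R Qf" and riccati: "riccati_solution A B Q R P"
    and W: "0 \<le> W"
begin

definition G :: "real^'d^'d" where
  "G = R + transpose B ** P ** B"

text \<open>The usual feedback gain is L P A. The factor P A is left out because the same L also
  acts on the term from future disturbances.\<close>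

definition L :: "real^'n^'d" where
  "L = matrix_inv G ** transpose B"

definition F :: "real^'n^'n" where
  "F = closed_loop A B R P"

lemma psd: "pos_semidef Q" "pos_semidef Qf" "pos_semidef P" "pos_def R"
  using lqr riccati by (simp_all add: lqr_assumptions_def riccati_solution_def)

lemma quad_nonneg: "0 \<le> x \<bullet> (Q *v x)" "0 \<le> x \<bullet> (Qf *v x)" "0 \<le> x \<bullet> (P *v x)"
  "0 \<le> u \<bullet> (R *v u)"
  using psd pos_def_imp_pos_semidef[OF psd(4)] by (auto simp: pos_semidef_def)

lemma G_vec: "G *v u = R *v u + transpose B *v (P *v (B *v u))"
  unfolding G_def matrix_vector_mult_add_rdistrib
  by (simp only: matrix_vector_mul_assoc matrix_mul_assoc)

lemma G_quad: "u \<bullet> (G *v u) = u \<bullet> (R *v u) + (B *v u) \<bullet> (P *v (B *v u))"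
  unfolding G_vec inner_add_right inner_transpose(2) by (simp add: inner_commute)

lemma G_nonneg: "0 \<le> u \<bullet> (G *v u)"
  unfolding G_quad using quad_nonneg by simp

lemma sym: "transpose P = P" "transpose R = R" "transpose G = G"
proof -
  show P: "transpose P = P" and R: "transpose R = R"
    using psd by (auto simp: pos_semidef_def pos_def_def)
  have "transpose G = transpose R + transpose (transpose B ** P ** B)"
    unfolding G_def by (simp add: transpose_def vec_eq_iff)
  then show "transpose G = G"
    unfolding G_def by (simp add: P R matrix_transpose_mul matrix_mul_assoc)
qed

lemma invertible_G: "invertible G"
proof (rule invertible_injective)
  fix u assume "G *v u = 0"
  then have "u \<bullet> (R *v u) \<le> 0"
    using G_quad[of u] quad_nonneg(3)[of "B *v u"] by simp
  then show "u = 0" using psd(4) unfolding pos_def_def by force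
qed

lemma G_L: "G *v (L *v z) = transpose B *v z"
  unfolding L_def matrix_vector_mul_assoc[symmetric] by (rule matrix_inv_vector(1)[OF invertible_G])

lemma F_vec: "F *v x = A *v x - B *v (L *v (P *v (A *v x)))"
  unfolding F_def closed_loop_def L_def G_def matrix_vector_mult_diff_rdistrib
  by (simp only: matrix_vector_mul_assoc matrix_mul_assoc)

lemma P_vec: "P *v x = Q *v x + transpose A *v (P *v (A *v x))
    - transpose A *v (P *v (B *v (L *v (P *v (A *v x)))))"
proof -
  have P: "P = Q + transpose A ** P ** A
           - transpose A ** P ** B ** matrix_inv (R + transpose B ** P ** B)
               ** transpose B ** P ** A"
    using riccati by (simp only: riccati_solution_def)
  show ?thesis
    by (subst P) (simp only: L_def G_def matrix_vector_mult_diff_rdistrib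
        matrix_vector_mult_add_rdistrib matrix_vector_mul_assoc matrix_mul_assoc)
qed

lemma B_L_sym: "(B *v (L *v a)) \<bullet> b = a \<bullet> (B *v (L *v b))"
proof -
  have "(B *v (L *v a)) \<bullet> b = (L *v a) \<bullet> (G *v (L *v b))"
    unfolding G_L inner_transpose ..
  also have "\<dots> = (G *v (L *v a)) \<bullet> (L *v b)" by (rule psd_form_sym[OF sym(3)])
  also have "\<dots> = a \<bullet> (B *v (L *v b))" unfolding G_L inner_transpose ..
  finally show ?thesis .
qed

text \<open>One step of dynamic programming. The value function at x is the P-form plus the linear
  term 2 x . F^T h; at the successor y the linear coefficient is h - P w, which equals F^T h' when h
  = P w + F^T h'. The deviation e from the minimising control pays e . G e, and the remaining
  bracket depends on neither x nor u.\<close>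

lemma complete_square:
  fixes x w h :: "real^'n" and u :: "real^'d"
  defines "y \<equiv> A *v x + B *v u + w" and "e \<equiv> u + L *v (P *v (A *v x) + h)"
  shows "x \<bullet> (Q *v x) + u \<bullet> (R *v u) + y \<bullet> (P *v y) + 2 * (y \<bullet> (h - P *v w))
    = x \<bullet> (P *v x) + 2 * (x \<bullet> (transpose F *v h)) + e \<bullet> (G *v e)
      + (w \<bullet> (P *v w) + 2 * (w \<bullet> (h - P *v w)) - (B *v (L *v h)) \<bullet> h)"
proof -
  define p where "p = A *v x"
  define a where "a = P *v p"
  define b where "b = B *v u"
  define z where "z = a + h"
  have Psym: "v \<bullet> (P *v v') = v' \<bullet> (P *v v)" for v v'
    using psd_form_sym[OF sym(1), of v v'] by (simp add: inner_commute)
  have 1: "x \<bullet> (P *v x) = x \<bullet> (Q *v x) + p \<bullet> a - a \<bullet> (B *v (L *v a))"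
    using psd_form_sym[OF sym(1), of p]
    by (subst P_vec) (simp only: inner_add_right inner_diff_right inner_transpose a_def p_def)
  have 2: "x \<bullet> (transpose F *v h) = p \<bullet> h - a \<bullet> (B *v (L *v h))"
    unfolding inner_transpose F_vec by (simp add: inner_diff_left B_L_sym a_def p_def)
  have "e \<bullet> (G *v e) = u \<bullet> (G *v u) + 2 * (u \<bullet> (G *v (L *v z))) + (L *v z) \<bullet> (G *v (L *v z))"
    using psd_form_sym[OF sym(3), of "L *v z" u]
    by (simp add: e_def z_def a_def p_def matrix_vector_right_distrib inner_add_left inner_add_right
        inner_commute)
  also have "\<dots> = u \<bullet> (R *v u) + b \<bullet> (P *v b) + 2 * (b \<bullet> z) + (B *v (L *v z)) \<bullet> z"
    unfolding G_L inner_transpose G_quad by (simp add: b_def)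
  also have "(B *v (L *v z)) \<bullet> z
      = a \<bullet> (B *v (L *v a)) + 2 * (a \<bullet> (B *v (L *v h))) + (B *v (L *v h)) \<bullet> h"
    unfolding B_L_sym using B_L_sym[of a h]
    by (simp add: z_def matrix_vector_right_distrib inner_add_left inner_add_right inner_commute)
  finally have 3: "e \<bullet> (G *v e) = u \<bullet> (R *v u) + b \<bullet> (P *v b) + 2 * (b \<bullet> z)
      + (a \<bullet> (B *v (L *v a)) + 2 * (a \<bullet> (B *v (L *v h))) + (B *v (L *v h)) \<bullet> h)" .
  have 4: "y \<bullet> (P *v y) = p \<bullet> a + b \<bullet> (P *v b) + w \<bullet> (P *v w)
      + 2 * (b \<bullet> a) + 2 * (p \<bullet> (P *v w)) + 2 * (b \<bullet> (P *v w))"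
    using Psym[of w p] Psym[of w b] Psym[of p b]
    by (simp add: y_def p_def[symmetric] a_def b_def[symmetric] matrix_vector_right_distrib
        inner_add_left inner_add_right)
  have 5: "y \<bullet> (h - P *v w) = p \<bullet> h + b \<bullet> h + w \<bullet> h - p \<bullet> (P *v w) - b \<bullet> (P *v w) - w \<bullet> (P *v w)"
    by (simp add: y_def p_def b_def inner_add_left inner_diff_right)
  show ?thesis unfolding 1 2 3 4 5 by (simp add: z_def inner_add_right inner_diff_right)
qed

lemma lyapunov:
  "x \<bullet> (P *v x) = x \<bullet> (Q *v x) + (L *v (P *v (A *v x))) \<bullet> (R *v (L *v (P *v (A *v x))))
     + (F *v x) \<bullet> (P *v (F *v x))"
  using complete_square[of x "- (L *v (P *v (A *v x)))" 0 0]
  by (simp add: F_vec vec.neg)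

lemma detector_vec:
  "transpose (transpose A - Q ** K) *v z = A *v z - transpose K *v (Q *v z)"
proof -
  have "transpose (Q ** K) = transpose K ** Q"
    using psd(1) by (simp add: matrix_transpose_mul pos_semidef_def)
  then have "transpose (transpose A - Q ** K) = A - transpose K ** Q"
    by (simp add: transpose_def vec_eq_iff)
  then show ?thesis
    by (simp only: matrix_vector_mult_diff_rdistrib matrix_vector_mul_assoc)
qed

text \<open>For an eigenvector x + i y with eigenvalue of modulus at least 1 the Lyapunov identity
  leaves no room for cost, so Q and the feedback vanish on x and y. There F agrees with A and hence
  with the detector matrix A - K^T Q, which is stable.\<close>

lemma spectral_radius_F: "spectral_radius F < 1"
  unfolding spectral_radius_less_iff
proof (intro ballI, rule ccontr)
  fix c assume "c \<in> eigenvalues F" and c: "\<not> cmod c < 1"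
  then obtain v where v: "v \<noteq> 0" "map_matrix complex_of_real F *v v = c *s v"
    by (auto simp: eigenvalues_def)
  define a b where "a = Re c" "b = Im c"
  define x y where "x = (\<chi> i. Re (v $ i))" "y = (\<chi> i. Im (v $ i))"
  have comp: "(\<Sum>j\<in>UNIV. complex_of_real (F $ i $ j) * v $ j) = c * v $ i" for i
    using v(2) by (auto simp: vec_eq_iff matrix_vector_mult_def map_matrix_def)
  have Fx: "F *v x = a *\<^sub>R x - b *\<^sub>R y"
    using arg_cong[where f = Re, OF comp]
    by (simp add: vec_eq_iff matrix_vector_mult_def a_b_def x_y_def)
  have Fy: "F *v y = a *\<^sub>R y + b *\<^sub>R x"
    using arg_cong[where f = Im, OF comp]
    by (simp add: vec_eq_iff matrix_vector_mult_def a_b_def x_y_def)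
  have ab: "1 \<le> a\<^sup>2 + b\<^sup>2"
    using c unfolding a_b_def cmod_power2[symmetric] by (simp add: one_le_power)
  define k where "k z = L *v (P *v (A *v z))" for z
  have Psym: "x \<bullet> (P *v y) = y \<bullet> (P *v x)"
    using psd_form_sym[OF sym(1), of x y] by (simp add: inner_commute)
  \<comment> \<open>Adding the real and imaginary parts cancels the cross terms; this is the
    Hermitian form of P written over the reals.\<close>
  have "(F *v x) \<bullet> (P *v (F *v x)) + (F *v y) \<bullet> (P *v (F *v y))
      = (a\<^sup>2 + b\<^sup>2) * (x \<bullet> (P *v x) + y \<bullet> (P *v y))"
    unfolding Fx Fy using Psym
    by (simp add: matrix_vector_mult_diff_distrib matrix_vector_right_distrib
        matrix_vector_mult_scaleR inner_diff_left inner_diff_right inner_add_left inner_add_right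
        algebra_simps power2_eq_square)
  moreover have "1 * (x \<bullet> (P *v x) + y \<bullet> (P *v y)) \<le> (a\<^sup>2 + b\<^sup>2) * (x \<bullet> (P *v x) + y \<bullet> (P *v y))"
    using ab quad_nonneg by (intro mult_right_mono) auto
  ultimately have sum: "x \<bullet> (Q *v x) + k x \<bullet> (R *v k x) + (y \<bullet> (Q *v y) + k y \<bullet> (R *v k y)) \<le> 0"
    using lyapunov[of x] lyapunov[of y] by (simp add: k_def)
  have nonneg: "0 \<le> x \<bullet> (Q *v x)" "0 \<le> k x \<bullet> (R *v k x)" "0 \<le> y \<bullet> (Q *v y)" "0 \<le> k y \<bullet> (R *v k y)"
    by (rule quad_nonneg)+
  have zero: "x \<bullet> (Q *v x) = 0" "y \<bullet> (Q *v y) = 0" "k x \<bullet> (R *v k x) = 0" "k y \<bullet> (R *v k y) = 0"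
    using sum nonneg by linarith+
  have Q0: "Q *v z = 0" if "z \<bullet> (Q *v z) = 0" for z
  proof -
    obtain c where "c > 0" and c: "\<And>x. (norm (Q *v x))\<^sup>2 \<le> c * (x \<bullet> (Q *v x))"
      using psd_norm_le[OF psd(1)] by blast
    show ?thesis using c[of z] that by simp
  qed
  have R0: "z = 0" if "z \<bullet> (R *v z) = 0" for z
    using psd(4) that unfolding pos_def_def by force
  obtain K where K: "spectral_radius (transpose A - Q ** K) < 1"
    using lqr unfolding lqr_assumptions_def detectable_def stabilizable_def by blast
  obtain C r where "stable_matrix (transpose A - Q ** K) C r"
    using stable_matrix_spectral_radius[OF K] by blast
  then have st: "stable_matrix (transpose (transpose A - Q ** K)) C r"
    by (rule stable_matrix_transpose)
  have "k x = 0" "k y = 0" using R0 zero by blast+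
  then have "A *v x = F *v x" "A *v y = F *v y"
    using F_vec[of x] F_vec[of y] unfolding k_def by simp_all
  then have "x = 0 \<and> y = 0"
    using stable_matrix_real_eigenpair[OF st, of x a b y] ab Fx Fy Q0[OF zero(1)] Q0[OF zero(2)] unfolding detector_vec by simp
  then have "v = 0" by (auto simp: x_y_def vec_eq_iff complex_eq_iff)
  with v(1) show False by simp
qed

lemma stable_F: obtains C r where "stable_matrix F C r"
  using stable_matrix_spectral_radius[OF spectral_radius_F] by blast

section \<open>The cost as a sum of squared deviations\<close>

abbreviation state where "state \<equiv> lqr_state A B x0"

definition stage :: "(nat \<Rightarrow> real^'d) \<Rightarrow> (nat \<Rightarrow> real^'n) \<Rightarrow> nat \<Rightarrow> real" where
  "stage u w t = state u w t \<bullet> (Q *v state u w t) + u t \<bullet> (R *v u t)"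

lemma stage_nonneg: "0 \<le> stage u w t"
  using quad_nonneg by (simp add: stage_def)

lemma cost_stage:
  "lqr_cost A B Q R Z x0 T u w = (\<Sum>t<T. stage u w t) + state u w T \<bullet> (Z *v state u w T)"
  by (simp add: lqr_cost_def stage_def Let_def)

text \<open>The window length N is kept free: N = T - t gives the whole future, smaller N what is
  predicted.\<close>

definition H :: "(nat \<Rightarrow> real^'n) \<Rightarrow> nat \<Rightarrow> nat \<Rightarrow> real^'n" where
  "H w t N = (\<Sum>j<N. mat_pow (transpose F) j *v (P *v w (t + j)))"

lemma H_Suc: "H w t (Suc N) = P *v w t + transpose F *v H w (Suc t) N"
  unfolding H_def sum.lessThan_Suc_shift
  by (simp add: vec.sum matrix_vector_mul_assoc[symmetric] del: transpose_matrix_vector)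

text \<open>The tail beyond a window of length k carries the factor (F^T)^k. This is where the norm
  of F^k in both bounds comes from.\<close>

lemma H_add: "H w t (k + N) = H w t k + mat_pow (transpose F) k *v H w (t + k) N"
proof -
  have "H w t (k + N) = H w t k + (\<Sum>j<N. mat_pow (transpose F) (k + j) *v (P *v w (t + (k + j))))"
    unfolding H_def by (simp add: sum_lessThan_split[of k "k + N"])
  then show ?thesis by (simp add: H_def vec.sum mat_pow_add add.assoc)
qed

(* Deviation of u_t from the control that is optimal for the terminal weight P. *)
definition dev :: "(nat \<Rightarrow> real^'d) \<Rightarrow> (nat \<Rightarrow> real^'n) \<Rightarrow> nat \<Rightarrow> nat \<Rightarrow> real^'d" where
  "dev u w T t = u t + L *v (P *v (A *v state u w t) + H w t (T - t))"

text \<open>The one-step identity telescopes. The constant \<phi> depends on w and T but is common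
  to all controls, so comparing costs means comparing deviations.\<close>

lemma cost_P_eq:
  "\<exists>\<phi>. \<forall>u. lqr_cost A B Q R P x0 T u w = \<phi> + (\<Sum>t<T. dev u w T t \<bullet> (G *v dev u w T t))"
proof -
  define h where "h t = H w t (T - t)" for t
  define c where "c t = w t \<bullet> (P *v w t) + 2 * (w t \<bullet> (h t - P *v w t)) - (B *v (L *v h t)) \<bullet> h t" for t
  define V where "V x t = x \<bullet> (P *v x) + 2 * (x \<bullet> (transpose F *v h t))" for x t
  have h: "h t - P *v w t = transpose F *v h (Suc t)" if "t < T" for t
    using that H_Suc[of w t "T - Suc t"] by (simp add: h_def Suc_diff_Suc del: transpose_matrix_vector)
  \<comment> \<open>No disturbance is left at T, so the value function ends as the P-form, that is,
    as the terminal cost with weight P.\<close>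
  have hT: "h T = 0" by (simp add: h_def H_def)
  have "(\<Sum>t<n. stage u w t) + V (state u w n) n
      = V x0 0 + (\<Sum>t<n. c t) + (\<Sum>t<n. dev u w T t \<bullet> (G *v dev u w T t))" if "n \<le> T" for u n
    using that
  proof (induction n)
    case (Suc n)
    have "stage u w n + V (state u w (Suc n)) (Suc n)
        = V (state u w n) n + c n + dev u w T n \<bullet> (G *v dev u w T n)"
      using complete_square[of "state u w n" "u n" "w n" "h n"] h[of n] Suc.prems
      by (simp add: stage_def V_def c_def dev_def h_def del: transpose_matrix_vector)
    then show ?case using Suc by simp
  qed simp
  from this[of T]
  have "lqr_cost A B Q R P x0 T u w
      = (V x0 0 + (\<Sum>t<T. c t)) + (\<Sum>t<T. dev u w T t \<bullet> (G *v dev u w T t))" for u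
    unfolding cost_stage by (simp add: V_def hT)
  then show ?thesis by blast
qed

text \<open>Entries from T on stay free: in the game w is \<open>(!) ws\<close>, unspecified beyond
  the end of the list.\<close>

definition admissible :: "nat \<Rightarrow> (nat \<Rightarrow> real^'n) \<Rightarrow> bool" where
  "admissible T w \<longleftrightarrow> (\<forall>t<T. norm (w t) \<le> W)"

lemma H_bound:
  obtains b where "0 \<le> b" "\<And>T w t N. admissible T w \<Longrightarrow> t + N \<le> T \<Longrightarrow> norm (H w t N) \<le> b"
proof -
  obtain C r where "stable_matrix F C r" using stable_F by blast
  then have st: "stable_matrix (transpose F) C r" by (rule stable_matrix_transpose)
  interpret stable_matrix "transpose F" C r by fact
  obtain p where p: "p > 0" "\<And>x. norm (P *v x) \<le> p * norm x" using matrix_bound by blast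
  define b where "b = C * p * W / (1 - r)"
  have "norm (H w t N) \<le> b" if w: "admissible T w" and N: "t + N \<le> T" for T w t N
  proof -
    have "norm (H w t N) \<le> (\<Sum>j<N. C * p * W * r ^ j)"
      unfolding H_def
    proof (rule sum_norm_le)
      fix j assume "j \<in> {..<N}"
      then have wj: "norm (w (t + j)) \<le> W" using w N by (simp add: admissible_def)
      have "norm (P *v w (t + j)) \<le> p * W"
        using p(2)[of "w (t + j)"] mult_left_mono[OF wj, of p] p(1) by linarith
      then have "C * r ^ j * norm (P *v w (t + j)) \<le> C * r ^ j * (p * W)"
        using C r by (intro mult_left_mono) auto
      then show "norm (mat_pow (transpose F) j *v (P *v w (t + j))) \<le> C * p * W * r ^ j"
        using pow[of j "P *v w (t + j)"] by (simp add: mult_ac)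
    qed
    also have "\<dots> = C * p * W * ((1 - r ^ N) / (1 - r))"
      using r by (simp add: sum_distrib_left[symmetric] sum_gp_strict)
    also have "\<dots> \<le> C * p * W * (1 / (1 - r))"
      using C p W r by (intro mult_left_mono divide_right_mono) auto
    finally show ?thesis by (simp add: b_def)
  qed
  moreover have "0 \<le> b" using C p W r by (simp add: b_def)
  ultimately show ?thesis using that by blast
qed

text \<open>A strategy in the game is a function of the disturbances, so the closed-loop state is
  simulated from them; \<open>state_mpc\<close> confirms the simulation. The \<open>min\<close>
  shortens the window when fewer than k steps remain.\<close>

primrec mpc_state :: "nat \<Rightarrow> nat \<Rightarrow> (nat \<Rightarrow> real^'n) \<Rightarrow> nat \<Rightarrow> real^'n" where
  "mpc_state k T w 0 = x0"
| "mpc_state k T w (Suc t) = F *v mpc_state k T w t + (w t - B *v (L *v H w t (min k (T - t))))"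

definition mpc :: "nat \<Rightarrow> nat \<Rightarrow> (nat \<Rightarrow> real^'n) \<Rightarrow> nat \<Rightarrow> real^'d" where
  "mpc k T w t = - (L *v (P *v (A *v mpc_state k T w t) + H w t (min k (T - t))))"

lemma state_mpc: "state (mpc k T w) w t = mpc_state k T w t"
  by (induction t) (simp_all add: mpc_def F_vec matrix_vector_right_distrib matrix_vector_mult_diff_distrib vec.neg)

lemma H_cong: "(\<And>i. i < t + N \<Longrightarrow> w i = w' i) \<Longrightarrow> H w t N = H w' t N"
  unfolding H_def by (intro sum.cong) auto

lemma mpc_state_causal:
  assumes "\<And>i. i < t + k \<Longrightarrow> i < T \<Longrightarrow> w i = w' i" "t \<le> T"
  shows "mpc_state k T w t = mpc_state k T w' t"
  using assms
proof (induction t)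
  case (Suc t)
  have "H w t (min k (T - t)) = H w' t (min k (T - t))"
    using Suc.prems by (intro H_cong) auto
  moreover have "w t = w' t" using Suc.prems by auto
  ultimately show ?case using Suc by simp
qed simp

text \<open>The indices below t + k are exactly the disturbances revealed before u_t is chosen in
  the game.\<close>

lemma mpc_causal:
  assumes "\<And>i. i < t + k \<Longrightarrow> i < T \<Longrightarrow> w i = w' i" "t < T"
  shows "mpc k T w t = mpc k T w' t"
proof -
  have "H w t (min k (T - t)) = H w' t (min k (T - t))"
    using assms by (intro H_cong) auto
  moreover have "mpc_state k T w t = mpc_state k T w' t"
    using assms by (intro mpc_state_causal) auto
  ultimately show ?thesis by (simp add: mpc_def)
qed

lemma dev_mpc:
  assumes "t < T"
  shows "dev (mpc k T w) w T t = L *v (mat_pow (transpose F) k *v H w (t + k) (T - t - k))"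
proof -
  have "H w t (T - t) - H w t (min k (T - t)) = mat_pow (transpose F) k *v H w (t + k) (T - t - k)"
  proof (cases "k \<le> T - t")
    case True
    then have "k + (T - t - k) = T - t" by simp
    with H_add[of w t k "T - t - k"] True show ?thesis
      by (simp del: transpose_matrix_vector)
  next
    \<comment> \<open>The window covers all remaining disturbances; truncated subtraction makes the
      tail empty, so the deviation is 0.\<close>
    case False
    then show ?thesis by (simp add: H_def)
  qed
  then have "L *v (H w t (T - t) - H w t (min k (T - t))) =  L *v (mat_pow (transpose F) k *v H w (t + k) (T - t - k))"
    by simp
  then show ?thesis
    unfolding dev_def state_mpc
    by (simp add: mpc_def matrix_vector_right_distrib matrix_vector_mult_diff_distrib)
qed

lemma dev_mpc_bound:
  obtains c where "0 \<le> c" "\<And>k T w. admissible T w \<Longrightarrow>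
    (\<Sum>t<T. dev (mpc k T w) w T t \<bullet> (G *v dev (mpc k T w) w T t)) \<le> c * ((spectral_norm (mat_pow F k))\<^sup>2 * real T)"
proof -
  obtain b where b: "0 \<le> b" "\<And>T w t N. admissible T w \<Longrightarrow> t + N \<le> T \<Longrightarrow> norm (H w t N) \<le> b"
    using H_bound by metis
  obtain g where g: "g > 0" "\<And>x. norm (G *v x) \<le> g * norm x" using matrix_bound by blast
  obtain l where l: "l > 0" "\<And>x. norm (L *v x) \<le> l * norm x" using matrix_bound by blast
  define c where "c = g * (l * b)\<^sup>2"
  have "(\<Sum>t<T. dev (mpc k T w) w T t \<bullet> (G *v dev (mpc k T w) w T t)) \<le> c * ((spectral_norm (mat_pow F k))\<^sup>2 * real T)"
    if w: "admissible T w" for k T w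
  proof -
    define f where "f = spectral_norm (mat_pow F k)"
    have f: "0 \<le> f" by (simp add: f_def spectral_norm_nonneg)
    have tr: "norm (mat_pow (transpose F) k *v x) \<le> f * norm x" for x
      unfolding f_def by (intro norm_mat_pow_transpose_le norm_le_spectral_norm)
    have "dev (mpc k T w) w T t \<bullet> (G *v dev (mpc k T w) w T t) \<le> c * f\<^sup>2" if "t < T" for t
    proof -
      define e where "e = dev (mpc k T w) w T t"
      have Hb: "norm (H w (t + k) (T - t - k)) \<le> b"
      proof (cases "t + k \<le> T")
        case True
        then show ?thesis using w by (intro b(2)[of T]) auto
      next
        case False
        then show ?thesis using b(1) by (simp add: H_def)
      qed
      have "norm e \<le> l * (f * b)"
        unfolding e_def dev_mpc[OF that]
        using l(2)[of "mat_pow (transpose F) k *v H w (t + k) (T - t - k)"]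
          tr[of "H w (t + k) (T - t - k)"] mult_left_mono[OF Hb f] l(1)
        by (meson less_imp_le mult_left_mono order_trans)
      then have "(norm e)\<^sup>2 \<le> (l * (f * b))\<^sup>2" by (intro power_mono) auto
      moreover have "e \<bullet> (G *v e) \<le> norm e * (g * norm e)"
        using norm_cauchy_schwarz[of e "G *v e"] mult_left_mono[OF g(2)[of e] norm_ge_zero[of e]]
        by linarith
      ultimately have "e \<bullet> (G *v e) \<le> g * (l * (f * b))\<^sup>2"
        using g(1) by (smt (verit) mult.left_commute mult_left_mono power2_eq_square)
      then show ?thesis by (simp add: e_def c_def power_mult_distrib mult_ac)
    qed
    then have "(\<Sum>t<T. dev (mpc k T w) w T t \<bullet> (G *v dev (mpc k T w) w T t)) \<le> (\<Sum>t<T. c * f\<^sup>2)"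
      by (intro sum_mono) auto
    then show ?thesis by (simp add: f_def mult_ac)
  qed
  moreover have "0 \<le> c" using g by (simp add: c_def)
  ultimately show ?thesis using that by blast
qed

text \<open>Uniformity in k and T makes the exchange of the terminal weight P for Qf cost a constant
  only.\<close>

lemma mpc_state_bound:
  obtains b where "0 \<le> b" "\<And>k T w. admissible T w \<Longrightarrow> norm (mpc_state k T w T) \<le> b"
proof -
  obtain C r where st: "stable_matrix F C r" using stable_F by blast
  interpret stable_matrix F C r by fact
  obtain b where b: "0 \<le> b" "\<And>T w t N. admissible T w \<Longrightarrow> t + N \<le> T \<Longrightarrow> norm (H w t N) \<le> b"
    using H_bound by metis
  obtain l where l: "l > 0" "\<And>x. norm ((B ** L) *v x) \<le> l * norm x" using matrix_bound by blast
  have "norm (mpc_state k T w T) \<le> C * norm x0 + C * (W + l * b) / (1 - r)"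
    if w: "admissible T w" for k T w
  proof -
    have "norm (mpc_state k T w (Suc t) - F *v mpc_state k T w t) \<le> W + l * b" if "t < T" for t
    proof -
      have "norm (H w t (min k (T - t))) \<le> b" using w that by (intro b(2)[of T]) auto
      then have "norm (B *v (L *v H w t (min k (T - t)))) \<le> l * b"
        using l(2)[of "H w t (min k (T - t))"] l(1)
        by (smt (verit) matrix_vector_mul_assoc mult_left_mono)
      moreover have "norm (w t) \<le> W" using w that by (simp add: admissible_def)
      ultimately show ?thesis using norm_triangle_ineq4[of "w t"] by (smt (verit) mpc_state.simps(2) add_diff_cancel_left')
    qed
    from orbit_bound[of "W + l * b" T "mpc_state k T w", OF _ this] W l b show ?thesis by simp
  qed
  moreover have "0 \<le> C * norm x0 + C * (W + l * b) / (1 - r)" using C r W l b by simp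
  ultimately show ?thesis using that by blast
qed

section \<open>Tail costs and detectability\<close>

lemma quad_bound:
  fixes M :: "real^'m^'m"
  obtains c where "0 \<le> c" "\<And>x. x \<bullet> (M *v x) \<le> c * (norm x)\<^sup>2"
proof -
  obtain c where c: "c > 0" "\<And>x. norm (M *v x) \<le> c * norm x" using matrix_bound by blast
  have "x \<bullet> (M *v x) \<le> c * (norm x)\<^sup>2" for x
    using norm_cauchy_schwarz[of x "M *v x"] mult_left_mono[OF c(2)[of x] norm_ge_zero[of x]]
    by (simp add: power2_eq_square mult_ac)
  with c(1) show ?thesis using that[of c] by simp
qed

(* Switching to the stabilising feedback u = - L P A x at time s. *)
lemma splice_cost:
  fixes Z :: "real^'n^'n"
  obtains a b where "0 \<le> a" "0 \<le> b"
    "\<And>T w u s. admissible T w \<Longrightarrow> s \<le> T \<Longrightarrow> \<exists>v. lqr_cost A B Q R Z x0 T v w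
       \<le> (\<Sum>t<s. stage u w t) + a * (norm (state u w s))\<^sup>2 + b * real (T - s)"
proof -
  obtain C r where st: "stable_matrix F C r" using stable_F by blast
  interpret stable_matrix F C r by fact
  obtain q where q: "0 \<le> q" "\<And>x. x \<bullet> (Q *v x) \<le> q * (norm x)\<^sup>2" using quad_bound by blast
  obtain z where z: "0 \<le> z" "\<And>x. x \<bullet> (Z *v x) \<le> z * (norm x)\<^sup>2" using quad_bound by blast
  obtain \<rho> where \<rho>: "0 \<le> \<rho>" "\<And>x. x \<bullet> (R *v x) \<le> \<rho> * (norm x)\<^sup>2" using quad_bound by blast
  obtain l where l: "l > 0" "\<And>x. norm ((L ** P ** A) *v x) \<le> l * norm x" using matrix_bound by blast
  define D where "D = q + z + \<rho> * l\<^sup>2"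
  have D: "0 \<le> D" using q z \<rho> by (simp add: D_def)
  define a where "a = D * (C\<^sup>2 / (1 - r))"
  define b where "b = D * (C\<^sup>2 / (1 - r)\<^sup>2 * W\<^sup>2)"
  have "\<exists>v. lqr_cost A B Q R Z x0 T v w
       \<le> (\<Sum>t<s. stage u w t) + a * (norm (state u w s))\<^sup>2 + b * real (T - s)"
    if w: "admissible T w" and s: "s \<le> T" for T w u s
  proof -
    define y where "y = rec_nat (state u w s) (\<lambda>j x. F *v x + w (s + j))"
    have y: "y 0 = state u w s" "y (Suc j) = F *v y j + w (s + j)" for j
      by (simp_all add: y_def)
    define v where "v t = (if t < s then u t else - (L *v (P *v (A *v y (t - s)))))" for t
    have st1: "state v w t = state u w t" if "t \<le> s" for t
      using that by (intro lqr_state_cong) (simp add: v_def)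
    have st2: "state v w (s + j) = y j" for j
    proof (induction j)
      case (Suc j)
      then show ?case by (simp add: v_def y F_vec vec.neg)
    qed (simp add: st1 y)
    have s1: "stage v w t = stage u w t" if "t < s" for t
      using that st1[of t] by (simp add: stage_def v_def)
    have s2: "stage v w (s + j) \<le> (q + \<rho> * l\<^sup>2) * (norm (y j))\<^sup>2" for j
    proof -
      have "v (s + j) \<bullet> (R *v v (s + j)) \<le> \<rho> * (norm (v (s + j)))\<^sup>2" by (rule \<rho>)
      also have "norm (v (s + j)) \<le> l * norm (y j)"
        using l(2)[of "y j"] by (simp add: v_def matrix_vector_mul_assoc[symmetric])
      then have "\<rho> * (norm (v (s + j)))\<^sup>2 \<le> \<rho> * (l * norm (y j))\<^sup>2"
        using \<rho>(1) by (intro mult_left_mono power_mono) auto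
      finally show ?thesis using q(2)[of "y j"]
        unfolding stage_def st2 by (simp add: algebra_simps power_mult_distrib)
    qed
    define N where "N = T - s"
    have T: "T = s + N" using s by (simp add: N_def)
    have "(\<Sum>t<T. stage v w t) = (\<Sum>t<s. stage u w t) + (\<Sum>j<N. stage v w (s + j))"
      using sum_lessThan_split[OF s, of "stage v w"] s1 by (simp add: N_def)
    also have "(\<Sum>j<N. stage v w (s + j)) \<le> (\<Sum>j<N. D * (norm (y j))\<^sup>2)"
    proof (intro sum_mono)
      fix j
      have "(q + \<rho> * l\<^sup>2) * (norm (y j))\<^sup>2 \<le> D * (norm (y j))\<^sup>2"
        using z by (intro mult_right_mono) (auto simp: D_def)
      then show "stage v w (s + j) \<le> D * (norm (y j))\<^sup>2" using s2[of j] by linarith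
    qed
    finally have stages: "(\<Sum>t<T. stage v w t) \<le> (\<Sum>t<s. stage u w t) + (\<Sum>j<N. D * (norm (y j))\<^sup>2)"
      by simp
    have "state v w T \<bullet> (Z *v state v w T) \<le> D * (norm (y N))\<^sup>2"
    proof -
      have "z * (norm (y N))\<^sup>2 \<le> D * (norm (y N))\<^sup>2"
        using q \<rho> by (intro mult_right_mono) (auto simp: D_def)
      then show ?thesis using z(2)[of "y N"] unfolding T st2 by linarith
    qed
    \<comment> \<open>D dominates stage and terminal weights alike, so the terminal cost becomes the
      summand j = N.\<close>
    with stages have "lqr_cost A B Q R Z x0 T v w
        \<le> (\<Sum>t<s. stage u w t) + D * (\<Sum>j\<le>N. (norm (y j))\<^sup>2)"
      unfolding cost_stage by (simp add: lessThan_Suc_atMost[symmetric] sum_distrib_left distrib_left)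
    also have "D * (\<Sum>j\<le>N. (norm (y j))\<^sup>2)
        \<le> D * (C\<^sup>2 / (1 - r) * (norm (y 0))\<^sup>2 + C\<^sup>2 / (1 - r)\<^sup>2 * (\<Sum>j<N. W\<^sup>2))"
      using w by (intro mult_left_mono orbit_square_sum_bound D) (simp add: y admissible_def T)
    finally show ?thesis
      by (intro exI[of _ v]) (simp add: y a_def b_def N_def algebra_simps)
  qed
  moreover have "0 \<le> a" "0 \<le> b" using D r by (auto simp: a_def b_def)
  ultimately show ?thesis using that by blast
qed

text \<open>Along any trajectory x_{t+1} = (A - K^T Q) x_t + K^T Q x_t + B u_t + w_t with a stable
  first matrix. The squared norms of Q x and u are bounded by multiples of the two parts of the
  stage cost, so the forcing is summable in terms of cost plus time.\<close>

lemma detectable_orbit_bound: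
  obtains a b where "0 \<le> a" "0 \<le> b"
    "\<And>T w u s. admissible T w \<Longrightarrow> s \<le> T \<Longrightarrow> (\<Sum>j\<le>T - s. (norm (state u w (s + j)))\<^sup>2)
       \<le> a * (norm (state u w s))\<^sup>2 + b * ((\<Sum>j<T - s. stage u w (s + j)) + real (T - s))"
proof -
  obtain K where K: "spectral_radius (transpose A - Q ** K) < 1"
    using lqr unfolding lqr_assumptions_def detectable_def stabilizable_def by blast
  obtain C r where "stable_matrix (transpose A - Q ** K) C r"
    using stable_matrix_spectral_radius[OF K] by blast
  then have st: "stable_matrix (transpose (transpose A - Q ** K)) C r"
    by (rule stable_matrix_transpose)
  interpret stable_matrix "transpose (transpose A - Q ** K)" C r by fact
  obtain k where k: "k > 0" "\<And>x. norm (transpose K *v x) \<le> k * norm x" using matrix_bound by blast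
  obtain \<beta> where \<beta>: "\<beta> > 0" "\<And>x. norm (B *v x) \<le> \<beta> * norm x" using matrix_bound by blast
  obtain q where q: "q > 0" "\<And>x. (norm (Q *v x))\<^sup>2 \<le> q * (x \<bullet> (Q *v x))"
    using psd_norm_le[OF psd(1)] by blast
  obtain \<rho> where \<rho>: "\<rho> > 0" "\<And>x. (norm x)\<^sup>2 \<le> \<rho> * (x \<bullet> (R *v x))"
    using pos_def_norm_le[OF psd(4)] by blast
  define d where "d = 3 * (k\<^sup>2 * q + \<beta>\<^sup>2 * \<rho> + W\<^sup>2)"
  have d: "0 \<le> d" using q \<rho> by (simp add: d_def)
  have three: "(x + y + z)\<^sup>2 \<le> 3 * (x\<^sup>2 + y\<^sup>2 + z\<^sup>2)" for x y z :: real
  proof -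
    have "3 * (x\<^sup>2 + y\<^sup>2 + z\<^sup>2) - (x + y + z)\<^sup>2 = (x - y)\<^sup>2 + (y - z)\<^sup>2 + (x - z)\<^sup>2"
      by (simp add: power2_eq_square algebra_simps)
    then show ?thesis by (smt (verit) zero_le_power2)
  qed
  have "(\<Sum>j\<le>T - s. (norm (state u w (s + j)))\<^sup>2)
       \<le> C\<^sup>2 / (1 - r) * (norm (state u w s))\<^sup>2
         + (C\<^sup>2 / (1 - r)\<^sup>2 * d) * ((\<Sum>j<T - s. stage u w (s + j)) + real (T - s))"
    if w: "admissible T w" and s: "s \<le> T" for T w u s
  proof -
    define y where "y j = state u w (s + j)" for j
    have step: "(norm (y (Suc j) - transpose (transpose A - Q ** K) *v y j))\<^sup>2
        \<le> d * (stage u w (s + j) + 1)" if "j < T - s" for j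
    proof -
      have "y (Suc j) - transpose (transpose A - Q ** K) *v y j
          = transpose K *v (Q *v y j) + B *v u (s + j) + w (s + j)"
        unfolding detector_vec by (simp add: y_def)
      moreover have "norm (transpose K *v (Q *v y j) + B *v u (s + j) + w (s + j))
          \<le> k * norm (Q *v y j) + \<beta> * norm (u (s + j)) + W"
        using k(2)[of "Q *v y j"] \<beta>(2)[of "u (s + j)"] w that
        by (intro norm_triangle_mono) (auto simp: admissible_def)
      ultimately have "(norm (y (Suc j) - transpose (transpose A - Q ** K) *v y j))\<^sup>2
          \<le> (k * norm (Q *v y j) + \<beta> * norm (u (s + j)) + W)\<^sup>2"
        by (intro power_mono) simp_all
      also have "\<dots> \<le> 3 * (k\<^sup>2 * (norm (Q *v y j))\<^sup>2 + \<beta>\<^sup>2 * (norm (u (s + j)))\<^sup>2 + W\<^sup>2)"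
        using three[of "k * norm (Q *v y j)" "\<beta> * norm (u (s + j))" W] by (simp add: power_mult_distrib)
      also have "\<dots> \<le> 3 * (k\<^sup>2 * (q * (y j \<bullet> (Q *v y j))) + \<beta>\<^sup>2 * (\<rho> * (u (s + j) \<bullet> (R *v u (s + j)))) + W\<^sup>2)"
        using q(2)[of "y j"] \<rho>(2)[of "u (s + j)"] by (intro mult_left_mono add_mono) auto
      also have "\<dots> \<le> d * (stage u w (s + j) + 1)"
      proof -
        define Y U where "Y = y j \<bullet> (Q *v y j)" and "U = u (s + j) \<bullet> (R *v u (s + j))"
        have YU: "0 \<le> Y" "0 \<le> U" using quad_nonneg by (auto simp: Y_def U_def)
        have "d * (Y + U + 1) - 3 * (k\<^sup>2 * (q * Y) + \<beta>\<^sup>2 * (\<rho> * U) + W\<^sup>2)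
            = 3 * (k\<^sup>2 * q * (U + 1) + \<beta>\<^sup>2 * \<rho> * (Y + 1) + W\<^sup>2 * (Y + U))"
          by (simp add: d_def algebra_simps)
        moreover have "\<dots> \<ge> 0" using YU q \<rho> by (intro mult_nonneg_nonneg add_nonneg_nonneg) auto
        ultimately show ?thesis by (simp add: stage_def Y_def U_def y_def)
      qed
      finally show ?thesis .
    qed
    define S where "S = (\<Sum>j<T - s. (norm (y (Suc j) - transpose (transpose A - Q ** K) *v y j))\<^sup>2)"
    have "(\<Sum>j\<le>T - s. (norm (y j))\<^sup>2) \<le> C\<^sup>2 / (1 - r) * (norm (y 0))\<^sup>2 + C\<^sup>2 / (1 - r)\<^sup>2 * S"
      unfolding S_def by (rule orbit_square_sum_bound) simp
    moreover have "S \<le> (\<Sum>j<T - s. d * (stage u w (s + j) + 1))"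
      unfolding S_def using step by (intro sum_mono) auto
    then have "C\<^sup>2 / (1 - r)\<^sup>2 * S
        \<le> C\<^sup>2 / (1 - r)\<^sup>2 * (d * ((\<Sum>j<T - s. stage u w (s + j)) + real (T - s)))"
      by (intro mult_left_mono) (simp_all add: sum_distrib_left[symmetric] sum.distrib)
    ultimately show ?thesis by (simp add: y_def mult.assoc)
  qed
  moreover have "0 \<le> C\<^sup>2 / (1 - r)" "0 \<le> C\<^sup>2 / (1 - r)\<^sup>2 * d" using r d by auto
  ultimately show ?thesis using that by blast
qed

subsection \<open>Regret of the predictive controller\<close>

lemma cost_nonneg: "0 \<le> lqr_cost A B Q R Qf x0 T u w"
  unfolding cost_stage using quad_nonneg stage_nonneg by (intro add_nonneg_nonneg sum_nonneg) auto

lemma cost_ge_head: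
  assumes "s \<le> T"
  shows "(\<Sum>t<s. stage u w t) + (\<Sum>j<T - s. stage u w (s + j)) \<le> lqr_cost A B Q R Qf x0 T u w"
  unfolding cost_stage sum_lessThan_split[OF assms, symmetric] using quad_nonneg by simp

(* Along a nearly optimal trajectory the tail cost from any time s is at most
   a |x_s|^2 + b (T - s) + 1, and detectability bounds the squared states by it.  So the last time
   at which |x_s|^2 <= M cannot be far from the end. *)
lemma near_optimal_turnpike:
  obtains M N where "\<And>T w u. admissible T w
    \<Longrightarrow> (\<And>v. lqr_cost A B Q R Qf x0 T u w \<le> lqr_cost A B Q R Qf x0 T v w + 1)
    \<Longrightarrow> \<exists>s\<le>T. real (T - s) \<le> N \<and> (norm (state u w s))\<^sup>2 \<le> M"
proof -
  obtain a b where ab: "0 \<le> a" "0 \<le> b"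
    "\<And>T w u s. admissible T w \<Longrightarrow> s \<le> T \<Longrightarrow> \<exists>v. lqr_cost A B Q R Qf x0 T v w
       \<le> (\<Sum>t<s. stage u w t) + a * (norm (state u w s))\<^sup>2 + b * real (T - s)"
    by (fact splice_cost[of Qf])
  obtain a' b' where ab': "0 \<le> a'" "0 \<le> b'"
    "\<And>T w u s. admissible T w \<Longrightarrow> s \<le> T \<Longrightarrow> (\<Sum>j\<le>T - s. (norm (state u w (s + j)))\<^sup>2)
       \<le> a' * (norm (state u w s))\<^sup>2 + b' * ((\<Sum>j<T - s. stage u w (s + j)) + real (T - s))"
    by (fact detectable_orbit_bound)
  define \<alpha> \<beta> where "\<alpha> = a' + b' * a" and "\<beta> = b' * (b + 1)"
  have nn: "0 \<le> \<alpha>" "0 \<le> \<beta>" using ab ab' by (auto simp: \<alpha>_def \<beta>_def)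
  \<comment> \<open>M \<ge> |x0|^2 lets time 0 qualify, so a last time below the threshold exists; M
    \<ge> 2 \<beta> lets the term linear in n be absorbed; M \<ge> 1 lets M be divided out.\<close>
  define M where "M = max 1 (max ((norm x0)\<^sup>2) (2 * \<beta>))"
  have M: "1 \<le> M" "(norm x0)\<^sup>2 \<le> M" "2 * \<beta> \<le> M" by (auto simp: M_def)
  have "\<exists>s\<le>T. real (T - s) \<le> 2 * \<alpha> + 2 * b' \<and> (norm (state u w s))\<^sup>2 \<le> M"
    if w: "admissible T w"
      and opt: "\<And>v. lqr_cost A B Q R Qf x0 T u w \<le> lqr_cost A B Q R Qf x0 T v w + 1" for T w u
  proof -
    define S where "S = {s. s \<le> T \<and> (norm (state u w s))\<^sup>2 \<le> M}"
    have S: "finite S" "S \<noteq> {}" using M by (auto simp: S_def intro: exI[of _ 0])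
    define s where "s = Max S"
    have "s \<in> S" unfolding s_def using S by (rule Max_in)
    then have s: "s \<le> T" "(norm (state u w s))\<^sup>2 \<le> M" by (auto simp: S_def)
    define n where "n = T - s"
    have big: "M \<le> (norm (state u w (s + Suc j)))\<^sup>2" if "j < n" for j
    proof (rule ccontr)
      assume "\<not> ?thesis"
      then have "s + Suc j \<in> S" using that s(1) by (auto simp: S_def n_def)
      then have "s + Suc j \<le> s" unfolding s_def using S(1) by (intro Max_ge) auto
      then show False by simp
    qed
    obtain v where v: "lqr_cost A B Q R Qf x0 T v w
       \<le> (\<Sum>t<s. stage u w t) + a * (norm (state u w s))\<^sup>2 + b * real n"
      using ab(3)[OF w s(1)] unfolding n_def by blast
    have "(\<Sum>t<s. stage u w t) + (\<Sum>j<n. stage u w (s + j)) \<le> lqr_cost A B Q R Qf x0 T u w"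
      unfolding n_def by (rule cost_ge_head[OF s(1)])
    then have tail: "(\<Sum>j<n. stage u w (s + j)) \<le> a * (norm (state u w s))\<^sup>2 + b * real n + 1"
      using v opt[of v] by linarith
    have "M * real n = (\<Sum>j<n. M)" by simp
    also have "\<dots> \<le> (\<Sum>j<n. (norm (state u w (s + Suc j)))\<^sup>2)" using big by (intro sum_mono) auto
    also have "\<dots> \<le> (\<Sum>j\<le>n. (norm (state u w (s + j)))\<^sup>2)"
      by (subst sum.atMost_shift) simp
    also have "\<dots> \<le> a' * (norm (state u w s))\<^sup>2 + b' * ((\<Sum>j<n. stage u w (s + j)) + real n)"
      unfolding n_def by (rule ab'(3)[OF w s(1)])
    also have "\<dots> \<le> a' * (norm (state u w s))\<^sup>2 + b' * ((a * (norm (state u w s))\<^sup>2 + b * real n + 1) + real n)"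
      using tail ab' by (intro add_left_mono mult_left_mono) auto
    also have "\<dots> = \<alpha> * (norm (state u w s))\<^sup>2 + \<beta> * real n + b'"
      by (simp add: \<alpha>_def \<beta>_def algebra_simps)
    also have "\<dots> \<le> \<alpha> * M + M / 2 * real n + b' * M"
      using nn s(2) M ab'(2) mult_left_mono[of 1 M b']
      by (intro add_mono mult_left_mono mult_right_mono) auto
    finally have "M * real n \<le> M * (2 * \<alpha> + 2 * b')" by (simp add: algebra_simps)
    then have "real n \<le> 2 * \<alpha> + 2 * b'" using M(1) by simp
    then show ?thesis using s unfolding n_def by blast
  qed
  then show ?thesis using that by blast
qed

text \<open>The comparison goes through v, which follows u up to the time found by the turnpike
  argument and then the stabilising feedback. Its cost with weight P exceeds that of u with weight
  Qf by a constant only, and with weight P the deviation identity applies.\<close>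

lemma mpc_near_optimal:
  obtains c where "0 \<le> c" "\<And>k T w u. admissible T w
    \<Longrightarrow> (\<And>v. lqr_cost A B Q R Qf x0 T u w \<le> lqr_cost A B Q R Qf x0 T v w + 1)
    \<Longrightarrow> lqr_cost A B Q R Qf x0 T (mpc k T w) w
      \<le> lqr_cost A B Q R Qf x0 T u w + c * ((spectral_norm (mat_pow F k))\<^sup>2 * real T + 1)"
proof -
  obtain M N where MN: "\<And>T w u. admissible T w
    \<Longrightarrow> (\<And>v. lqr_cost A B Q R Qf x0 T u w \<le> lqr_cost A B Q R Qf x0 T v w + 1)
    \<Longrightarrow> \<exists>s\<le>T. real (T - s) \<le> N \<and> (norm (state u w s))\<^sup>2 \<le> M"
    by (rule near_optimal_turnpike) blast
  obtain a b where ab: "0 \<le> a" "0 \<le> b"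
    "\<And>T w u s. admissible T w \<Longrightarrow> s \<le> T \<Longrightarrow> \<exists>v. lqr_cost A B Q R P x0 T v w
       \<le> (\<Sum>t<s. stage u w t) + a * (norm (state u w s))\<^sup>2 + b * real (T - s)"
    by (fact splice_cost[of P])
  obtain c where c: "0 \<le> c" "\<And>k T w. admissible T w \<Longrightarrow>
    (\<Sum>t<T. dev (mpc k T w) w T t \<bullet> (G *v dev (mpc k T w) w T t)) \<le> c * ((spectral_norm (mat_pow F k))\<^sup>2 * real T)"
    by (fact dev_mpc_bound)
  obtain q where q: "0 \<le> q" "\<And>x. x \<bullet> (Qf *v x) \<le> q * (norm x)\<^sup>2" using quad_bound by blast
  obtain y where y: "0 \<le> y" "\<And>k T w. admissible T w \<Longrightarrow> norm (mpc_state k T w T) \<le> y"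
    by (fact mpc_state_bound)
  define c' where "c' = c + \<bar>a * M + b * N\<bar> + q * y\<^sup>2"
  have "lqr_cost A B Q R Qf x0 T (mpc k T w) w
      \<le> lqr_cost A B Q R Qf x0 T u w + c' * ((spectral_norm (mat_pow F k))\<^sup>2 * real T + 1)"
    if w: "admissible T w"
      and opt: "\<And>v. lqr_cost A B Q R Qf x0 T u w \<le> lqr_cost A B Q R Qf x0 T v w + 1" for k T w u
  proof -
    define g where "g = (spectral_norm (mat_pow F k))\<^sup>2 * real T"
    have g: "0 \<le> g" by (simp add: g_def)
    define m where "m = mpc k T w"
    obtain s where s: "s \<le> T" "real (T - s) \<le> N" "(norm (state u w s))\<^sup>2 \<le> M"
      using MN[OF w opt] by blast
    obtain v where v: "lqr_cost A B Q R P x0 T v w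
       \<le> (\<Sum>t<s. stage u w t) + a * (norm (state u w s))\<^sup>2 + b * real (T - s)"
      using ab(3)[OF w s(1)] by blast
    have "(\<Sum>t<s. stage u w t) \<le> lqr_cost A B Q R Qf x0 T u w"
      using cost_ge_head[OF s(1), of u w] sum_nonneg[of "{..<T - s}" "\<lambda>j. stage u w (s + j)"]
        stage_nonneg by fastforce
    moreover have "a * (norm (state u w s))\<^sup>2 + b * real (T - s) \<le> a * M + b * N"
      using ab s by (intro add_mono mult_left_mono) auto
    ultimately have v': "lqr_cost A B Q R P x0 T v w \<le> lqr_cost A B Q R Qf x0 T u w + (a * M + b * N)"
      using v by linarith
    obtain \<phi> where \<phi>: "\<And>u. lqr_cost A B Q R P x0 T u w = \<phi> + (\<Sum>t<T. dev u w T t \<bullet> (G *v dev u w T t))"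
      using cost_P_eq by metis
    \<comment> \<open>The constant \<phi> is the same for m and v, and the deviations of v only add
      to its cost.\<close>
    have "0 \<le> (\<Sum>t<T. dev v w T t \<bullet> (G *v dev v w T t))" by (intro sum_nonneg G_nonneg)
    moreover have "(\<Sum>t<T. dev m w T t \<bullet> (G *v dev m w T t)) \<le> c * g"
      unfolding m_def g_def by (rule c(2)[OF w])
    ultimately have 1: "lqr_cost A B Q R P x0 T m w \<le> lqr_cost A B Q R P x0 T v w + c * g"
      using \<phi>[of m] \<phi>[of v] by linarith
    have 2: "lqr_cost A B Q R Qf x0 T m w \<le> lqr_cost A B Q R P x0 T m w + q * y\<^sup>2"
    proof -
      have "q * (norm (state m w T))\<^sup>2 \<le> q * y\<^sup>2"
        unfolding m_def state_mpc using q(1) y(2)[OF w] by (intro mult_left_mono power_mono) auto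
      then show ?thesis unfolding cost_stage
        using q(2)[of "state m w T"] quad_nonneg(3)[of "state m w T"] by linarith
    qed
    have "c * g + (a * M + b * N) + q * y\<^sup>2 \<le> c * (g + 1) + \<bar>a * M + b * N\<bar> * (g + 1) + q * y\<^sup>2 * (g + 1)"
    proof -
      have "c * g + (a * M + b * N) + q * y\<^sup>2 \<le> c * (g + 1) + \<bar>a * M + b * N\<bar> + q * y\<^sup>2"
        using c(1) by (simp add: algebra_simps)
      moreover have "0 \<le> \<bar>a * M + b * N\<bar> * g" "0 \<le> q * y\<^sup>2 * g" using g q(1) by simp_all
      ultimately show ?thesis by (simp add: distrib_left)
    qed
    also have "\<dots> = c' * (g + 1)" by (simp add: c'_def algebra_simps)
    finally show ?thesis using 1 2 v' unfolding m_def g_def by linarith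
  qed
  moreover have "0 \<le> c'" using c q by (simp add: c'_def)
  ultimately show ?thesis using that by blast
qed

text \<open>Costs are nonnegative, so the infimum is finite and approached within 1. The second form
  is the same fact for the extended real infimum in the regret.\<close>

lemma exists_near_optimal:
  obtains u where "\<And>v. lqr_cost A B Q R Qf x0 T u w \<le> lqr_cost A B Q R Qf x0 T v w + 1"
    "ereal (lqr_cost A B Q R Qf x0 T u w - 1) \<le> (INF v. ereal (lqr_cost A B Q R Qf x0 T v w))"
proof -
  define f where "f u = lqr_cost A B Q R Qf x0 T u w" for u
  have bdd: "bdd_below (range f)" using cost_nonneg by (intro bdd_belowI2[of _ 0]) (auto simp: f_def)
  obtain u where u: "f u < Inf (range f) + 1"
    using cInf_lessD[of "range f" "Inf (range f) + 1"] by auto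
  have le: "f u \<le> f v + 1" for v using u cINF_lower[OF bdd, of v] by simp
  moreover have "ereal (f u - 1) \<le> (INF v. ereal (f v))"
    by (intro INF_greatest) (use le in \<open>simp add: algebra_simps\<close>)
  ultimately show ?thesis using that[of u] by (simp add: f_def)
qed

lemma regret_mpc_le:
  obtains c where "0 < c" "\<And>k T w. admissible T w \<Longrightarrow>
    lqr_regret A B Q R Qf x0 T (mpc k T w) w \<le> ereal (c * ((spectral_norm (mat_pow F k))\<^sup>2 * real T + 1))"
proof -
  obtain c where c: "0 \<le> c" "\<And>k T w u. admissible T w
    \<Longrightarrow> (\<And>v. lqr_cost A B Q R Qf x0 T u w \<le> lqr_cost A B Q R Qf x0 T v w + 1)
    \<Longrightarrow> lqr_cost A B Q R Qf x0 T (mpc k T w) w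
      \<le> lqr_cost A B Q R Qf x0 T u w + c * ((spectral_norm (mat_pow F k))\<^sup>2 * real T + 1)"
    by (fact mpc_near_optimal)
  \<comment> \<open>The additional 1 in c + 1 pays for u being optimal only up to 1.\<close>
  have "lqr_regret A B Q R Qf x0 T (mpc k T w) w \<le> ereal ((c + 1) * ((spectral_norm (mat_pow F k))\<^sup>2 * real T + 1))"
    if w: "admissible T w" for k T w
  proof -
    define g where "g = (spectral_norm (mat_pow F k))\<^sup>2 * real T"
    have g: "0 \<le> g" by (simp add: g_def)
    obtain u where u: "\<And>v. lqr_cost A B Q R Qf x0 T u w \<le> lqr_cost A B Q R Qf x0 T v w + 1"
      "ereal (lqr_cost A B Q R Qf x0 T u w - 1) \<le> (INF v. ereal (lqr_cost A B Q R Qf x0 T v w))"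
      by (fact exists_near_optimal[of T w])
    have "lqr_regret A B Q R Qf x0 T (mpc k T w) w
        \<le> ereal (lqr_cost A B Q R Qf x0 T (mpc k T w) w) - ereal (lqr_cost A B Q R Qf x0 T u w - 1)"
      unfolding lqr_regret_def using u(2) by (intro ereal_minus_mono) auto
    also have "\<dots> \<le> ereal ((c + 1) * (g + 1))"
      using c(2)[OF w u(1), of k] g unfolding g_def[symmetric] by (simp add: algebra_simps)
    finally show ?thesis by (simp add: g_def)
  qed
  then show ?thesis using that[of "c + 1"] c(1) by simp
qed

lemma regret_nonneg: "0 \<le> lqr_regret A B Q R Qf x0 T u w"
proof -
  have "(INF v. ereal (lqr_cost A B Q R Qf x0 T v w)) \<le> ereal (lqr_cost A B Q R Qf x0 T u w)"
    by (rule INF_lower) simp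
  moreover have "0 \<le> (INF v. ereal (lqr_cost A B Q R Qf x0 T v w))"
    by (intro INF_greatest) (simp add: cost_nonneg)
  ultimately show ?thesis unfolding lqr_regret_def
    by (cases "INF v. ereal (lqr_cost A B Q R Qf x0 T v w)") auto
qed

end

section \<open>Strategies in the minimax game\<close>

lemma minimax_nonneg:
  assumes "\<And>us ws. 0 \<le> g us ws" "\<Omega> \<noteq> {}"
  shows "0 \<le> minimax \<Omega> k g m us ws"
proof (induction m arbitrary: us ws)
  case 0
  show ?case by (auto intro!: INF_greatest assms)
next
  case (Suc m)
  \<comment> \<open>The supremum over an empty set would be minus infinity.\<close>
  from assms(2) obtain w where "w \<in> \<Omega>" by blast
  then show ?case by (auto intro!: INF_greatest SUP_upper2[of w] Suc)
qed

text \<open>The strategy is written as a function of the full disturbance sequence. Causality makes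
  it playable: extending the list of disturbances does not change the controls already played, so
  the invariant on \<open>us\<close> survives each round.\<close>

lemma minimax_le_strategy:
  assumes causal: "\<And>t w w'. t < T \<Longrightarrow> (\<And>i. i < t + k \<Longrightarrow> i < T \<Longrightarrow> w i = w' i) \<Longrightarrow> \<sigma> w t = \<sigma> w' t"
    and bound: "\<And>ws. length ws = T \<Longrightarrow> set ws \<subseteq> \<Omega> \<Longrightarrow> g (map (\<sigma> ((!) ws)) [0..<T]) ws \<le> b"
    and "length ws + m = T" "length ws = length us + k" "set ws \<subseteq> \<Omega>"
    and "us = map (\<sigma> ((!) ws)) [0..<length us]"
  shows "minimax \<Omega> k g m us ws \<le> b"
  using assms(3-)
proof (induction m arbitrary: us ws)
  case 0
  \<comment> \<open>All disturbances are known now, and the last k controls of the strategy are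
    played at once.\<close>
  define vs where "vs = map (\<sigma> ((!) ws)) [length us..<T]"
  have "us @ vs = map (\<sigma> ((!) ws)) ([0..<length us] @ [length us..<T])"
    unfolding map_append vs_def using 0(4) by simp
  also have "[0..<length us] @ [length us..<T] = [0..<T]"
    using 0 upt_add_eq_append[of 0 "length us" k] by simp
  finally have "g (us @ vs) ws \<le> b" using bound[of ws] 0 by simp
  moreover have "length vs = k" using 0 by (simp add: vs_def)
  ultimately show ?case by (auto intro: INF_lower2)
next
  case (Suc m)
  define u where "u = \<sigma> ((!) ws) (length us)"
  have "minimax \<Omega> k g m (us @ [u]) (ws @ [w]) \<le> b" if "w \<in> \<Omega>" for w
  proof (rule Suc.IH)
    \<comment> \<open>For t \<le> length us the revealed indices lie below t + k \<le> length ws,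
      hence before the appended w.\<close>
    have eq: "\<sigma> ((!) ws) t = \<sigma> ((!) (ws @ [w])) t" if "t \<le> length us" for t
      using that Suc.prems by (intro causal) (auto simp: nth_append)
    have "us @ [u] = map (\<sigma> ((!) ws)) [0..<length us] @ [\<sigma> ((!) ws) (length us)]"
      using Suc.prems(4) by (simp add: u_def)
    also have "\<dots> = map (\<sigma> ((!) (ws @ [w]))) [0..<length (us @ [u])]"
      using eq by simp
    finally show "us @ [u] = map (\<sigma> ((!) (ws @ [w]))) [0..<length (us @ [u])]" .
  qed (use Suc.prems that in auto)
  then show ?case by (auto intro!: INF_lower2[of u] SUP_least)
qed

context lqr
begin

lemma regret_cong:
  assumes "\<And>t. t < T \<Longrightarrow> u t = u' t"
  shows "lqr_regret A B Q R Qf x0 T u w = lqr_regret A B Q R Qf x0 T u' w"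
proof -
  have st: "state u w t = state u' w t" if "t \<le> T" for t
    using that assms by (intro lqr_state_cong) auto
  have "lqr_cost A B Q R Qf x0 T u w = lqr_cost A B Q R Qf x0 T u' w"
    unfolding cost_stage using st assms by (auto simp: stage_def intro!: sum.cong)
  then show ?thesis by (simp add: lqr_regret_def)
qed

lemma opt_dynamic_regret_bounds:
  assumes \<Omega>: "\<Omega> \<noteq> {}" "\<And>x. x \<in> \<Omega> \<Longrightarrow> norm x \<le> W"
  obtains c where "0 < c" "\<And>k T. k \<le> T \<Longrightarrow> \<bar>opt_dynamic_regret A B Q R Qf x0 \<Omega> k T\<bar>
    \<le> ereal (c * ((spectral_norm (mat_pow F k))\<^sup>2 * real T + 1))"
proof -
  obtain c where c: "0 < c" "\<And>k T w. admissible T w \<Longrightarrow>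
    lqr_regret A B Q R Qf x0 T (mpc k T w) w \<le> ereal (c * ((spectral_norm (mat_pow F k))\<^sup>2 * real T + 1))"
    by (fact regret_mpc_le)
  have "\<bar>opt_dynamic_regret A B Q R Qf x0 \<Omega> k T\<bar>
    \<le> ereal (c * ((spectral_norm (mat_pow F k))\<^sup>2 * real T + 1))" if k: "k \<le> T" for k T
  proof -
    let ?g = "\<lambda>us ws. lqr_regret A B Q R Qf x0 T (\<lambda>t. us ! t) (\<lambda>t. ws ! t)"
    have "minimax \<Omega> k ?g (T - k) [] ws \<le> ereal (c * ((spectral_norm (mat_pow F k))\<^sup>2 * real T + 1))"
      if "length ws = k" "set ws \<subseteq> \<Omega>" for ws
    proof (rule minimax_le_strategy[where \<sigma> = "mpc k T"])
      fix ws :: "(real^'n) list" assume ws: "length ws = T" "set ws \<subseteq> \<Omega>"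
      have "admissible T ((!) ws)"
        unfolding admissible_def using ws \<Omega>(2) by (metis nth_mem subsetD)
      then show "?g (map (mpc k T ((!) ws)) [0..<T]) ws
          \<le> ereal (c * ((spectral_norm (mat_pow F k))\<^sup>2 * real T + 1))"
        using c(2)[of T "(!) ws" k] by (subst regret_cong[where u' = "mpc k T ((!) ws)"]) simp_all
    qed (use that k in \<open>auto intro: mpc_causal\<close>)
    then have "opt_dynamic_regret A B Q R Qf x0 \<Omega> k T
        \<le> ereal (c * ((spectral_norm (mat_pow F k))\<^sup>2 * real T + 1))"
      unfolding opt_dynamic_regret_def by (intro SUP_least) auto
    \<comment> \<open>The estimate of the absolute value also needs a lower bound; any constant
      choice of the first k disturbances provides it.\<close>
    moreover have "0 \<le> opt_dynamic_regret A B Q R Qf x0 \<Omega> k T"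
    proof -
      obtain w where "w \<in> \<Omega>" using \<Omega>(1) by blast
      then have "replicate k w \<in> {ws. length ws = k \<and> set ws \<subseteq> \<Omega>}" by auto
      then show ?thesis unfolding opt_dynamic_regret_def
        by (rule SUP_upper2) (intro minimax_nonneg regret_nonneg \<Omega>(1))
    qed
    ultimately show ?thesis by simp
  qed
  with c(1) show ?thesis using that by blast
qed

text \<open>The midpoint of \<rho>(F) and 1 is strictly above \<rho>(F), as the growth bound for
  powers demands.\<close>

lemma spectral_norm_mat_pow_le:
  obtains c where "0 < c"
    "\<And>k. spectral_norm (mat_pow F k) \<le> c * ((1 + spectral_radius F) / 2) ^ k"
proof -
  have "spectral_radius F < (1 + spectral_radius F) / 2" using spectral_radius_F by simp
  from mat_pow_bound[OF this] obtain c where "c > 0"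
    "\<And>k x. norm (mat_pow F k *v x) \<le> c * ((1 + spectral_radius F) / 2) ^ k * norm x" by blast
  then show ?thesis using that[of c] spectral_norm_le by blast
qed

lemma spectral_norm_power_bound:
  obtains c where "0 < c" "\<And>k T. (spectral_norm (mat_pow F k))\<^sup>2 * real T + 1
    \<le> c * (((1 + spectral_radius F) / 2) ^ (2 * k) * real T + 1)"
proof -
  define r where "r = (1 + spectral_radius F) / 2"
  obtain c where c: "0 < c" "\<And>k. spectral_norm (mat_pow F k) \<le> c * r ^ k"
    using spectral_norm_mat_pow_le unfolding r_def by blast
  have "(spectral_norm (mat_pow F k))\<^sup>2 * real T + 1 \<le> (c\<^sup>2 + 1) * (r ^ (2 * k) * real T + 1)" for k T
  proof -
    have "(spectral_norm (mat_pow F k))\<^sup>2 \<le> (c * r ^ k)\<^sup>2"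
      using c(2) by (intro power_mono spectral_norm_nonneg)
    also have "\<dots> = c\<^sup>2 * r ^ (2 * k)" by (simp add: power_mult_distrib power_mult mult.commute[of 2 k])
    finally have "(spectral_norm (mat_pow F k))\<^sup>2 * real T \<le> c\<^sup>2 * r ^ (2 * k) * real T"
      by (intro mult_right_mono) auto
    moreover have "0 \<le> r ^ (2 * k) * real T" by simp
    moreover have "0 \<le> c\<^sup>2" by simp
    ultimately have "(spectral_norm (mat_pow F k))\<^sup>2 * real T + 1
        \<le> c\<^sup>2 * r ^ (2 * k) * real T + 1 + (r ^ (2 * k) * real T + c\<^sup>2)" by linarith
    then show ?thesis by (simp add: algebra_simps)
  qed
  then show ?thesis using that[of "c\<^sup>2 + 1"] c(1) by (simp add: r_def add_pos_pos)
qed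

subsection \<open>The randomised adversary\<close>

text \<open>With T predictions the controller sees the whole future and has no deviations, so it
  attains \<phi> and the offline infimum is at most \<phi>.\<close>

lemma regret_ge_deviation:
  assumes "Qf = P"
  shows "ereal (\<Sum>t<T. dev u w T t \<bullet> (G *v dev u w T t)) \<le> lqr_regret A B Q R Qf x0 T u w"
proof -
  obtain \<phi> where \<phi>: "\<And>u. lqr_cost A B Q R Qf x0 T u w = \<phi> + (\<Sum>t<T. dev u w T t \<bullet> (G *v dev u w T t))"
    using cost_P_eq assms by metis
  have "lqr_cost A B Q R Qf x0 T (mpc T T w) w = \<phi>"
    unfolding \<phi> by (simp add: dev_mpc H_def)
  then have "(INF v. ereal (lqr_cost A B Q R Qf x0 T v w)) \<le> ereal \<phi>"
    by (metis INF_lower UNIV_I)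
  then have "ereal (lqr_cost A B Q R Qf x0 T u w) - ereal \<phi> \<le> lqr_regret A B Q R Qf x0 T u w"
    unfolding lqr_regret_def by (intro ereal_minus_mono) auto
  then show ?thesis by (simp add: \<phi>)
qed

(* The part of the deviation at time t that is known once the controls us and the disturbances ws
   have been played. *)
definition known_dev :: "(real^'d) list \<Rightarrow> (real^'n) list \<Rightarrow> nat \<Rightarrow> real^'d" where
  "known_dev us ws t = us ! t + L *v (P *v (A *v state ((!) us) ((!) ws) t) + H ((!) ws) t (length ws - t))"

text \<open>A newly revealed w acts after time t on the state and so enters only as the last summand
  of \<open>H\<close>. For the newest control, t = length us, its exponent is exactly k.\<close>

lemma known_dev_append:
  assumes "t \<le> length us" "t \<le> length ws" "t < length us \<or> us' \<noteq> []"
  shows "known_dev (us @ us') (ws @ [w]) t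
    = known_dev (us @ us') ws t + L *v (mat_pow (transpose F) (length ws - t) *v (P *v w))"
proof -
  have "state ((!) (us @ us')) ((!) (ws @ [w])) t = state ((!) (us @ us')) ((!) ws) t"
    using assms by (intro lqr_state_cong) (auto simp: nth_append)
  moreover have "H ((!) (ws @ [w])) t (length (ws @ [w]) - t)
      = H ((!) ws) t (length ws - t) + mat_pow (transpose F) (length ws - t) *v (P *v w)"
  proof -
    have "H ((!) (ws @ [w])) t (length (ws @ [w]) - t) = H ((!) (ws @ [w])) t ((length ws - t) + 1)"
      using assms by (simp add: Suc_diff_le)
    also have "\<dots> = H ((!) (ws @ [w])) t (length ws - t)
        + mat_pow (transpose F) (length ws - t) *v H ((!) (ws @ [w])) (t + (length ws - t)) 1"
      by (rule H_add)
    also have "H ((!) (ws @ [w])) t (length ws - t) = H ((!) ws) t (length ws - t)"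
      using assms by (intro H_cong) (auto simp: nth_append)
    also have "H ((!) (ws @ [w])) (t + (length ws - t)) 1 = P *v w"
      using assms by (simp add: H_def)
    finally show ?thesis .
  qed
  ultimately show ?thesis by (simp add: known_dev_def matrix_vector_right_distrib add.assoc)
qed

lemma known_dev_append_controls:
  assumes "t < length us"
  shows "known_dev (us @ us') ws t = known_dev us ws t"
proof -
  have "state ((!) (us @ us')) ((!) ws) t = state ((!) us) ((!) ws) t"
    using assms by (intro lqr_state_cong) (auto simp: nth_append)
  then show ?thesis using assms by (simp add: known_dev_def nth_append)
qed

lemma parallelogram: "(norm (x + y))\<^sup>2 + (norm (x - y))\<^sup>2 = 2 * (norm x)\<^sup>2 + 2 * (norm (y :: real^'m))\<^sup>2"
  unfolding power2_norm_eq_inner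
  by (simp add: inner_add_left inner_add_right inner_diff_left inner_diff_right inner_commute)

(* The adversary picks each disturbance from e and - e.  By the parallelogram law the average over
   the sign does not decrease the squared known deviations, and it adds |d|^2 to the newest one. *)
lemma minimax_ge:
  assumes PQf: "Qf = P" and e: "e \<in> \<Omega>" "- e \<in> \<Omega>"
    and \<delta>: "0 \<le> \<delta>" "\<And>u. \<delta> * (norm u)\<^sup>2 \<le> u \<bullet> (G *v u)"
    and "length ws + m = T" "length ws = length us + k"
  defines "d \<equiv> L *v (mat_pow (transpose F) k *v (P *v e))"
  shows "ereal (\<delta> * ((\<Sum>t<length us. (norm (known_dev us ws t))\<^sup>2) + real m * (norm d)\<^sup>2))
    \<le> minimax \<Omega> k (\<lambda>us ws. lqr_regret A B Q R Qf x0 T (\<lambda>t. us ! t) (\<lambda>t. ws ! t)) m us ws"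
    (is "_ \<le> minimax \<Omega> k ?g m us ws")
  using assms(6,7)
proof (induction m arbitrary: us ws)
  case 0
  show ?case unfolding minimax.simps
  proof (rule INF_greatest)
    fix vs :: "(real^'d) list" assume "vs \<in> {vs. length vs = k}"
    have "\<delta> * (\<Sum>t<length us. (norm (known_dev us ws t))\<^sup>2)
        = (\<Sum>t<length us. \<delta> * (norm (known_dev (us @ vs) ws t))\<^sup>2)"
      by (simp add: sum_distrib_left known_dev_append_controls)
    also have "\<dots> \<le> (\<Sum>t<length us. known_dev (us @ vs) ws t \<bullet> (G *v known_dev (us @ vs) ws t))"
      by (intro sum_mono \<delta>)
    \<comment> \<open>The last k controls are chosen with full knowledge, so their terms are merely
      nonnegative; this is why T - k rather than T steps count.\<close>
    also have "\<dots> \<le> (\<Sum>t<T. known_dev (us @ vs) ws t \<bullet> (G *v known_dev (us @ vs) ws t))"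
      using 0 by (intro sum_mono2 G_nonneg) auto
    also have "\<dots> = (\<Sum>t<T. dev ((!) (us @ vs)) ((!) ws) T t \<bullet> (G *v dev ((!) (us @ vs)) ((!) ws) T t))"
      using 0 by (intro sum.cong) (auto simp: known_dev_def dev_def)
    finally show "ereal (\<delta> * ((\<Sum>t<length us. (norm (known_dev us ws t))\<^sup>2) + real 0 * (norm d)\<^sup>2))
        \<le> ?g (us @ vs) ws"
      using regret_ge_deviation[OF PQf, of "(!) (us @ vs)" "(!) ws" T]
      by (simp del: nth_append) (meson ereal_less_eq(3) order_trans)
  qed
next
  case (Suc m)
  define \<Psi> where "\<Psi> us ws = (\<Sum>t<length us. (norm (known_dev us ws t))\<^sup>2)" for us ws
  show ?case unfolding minimax.simps
  proof (rule INF_greatest)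
    fix u :: "real^'d"
    define y where "y t = known_dev (us @ [u]) ws t" for t
    define z where "z t = L *v (mat_pow (transpose F) (length ws - t) *v (P *v e))" for t
    have kd: "known_dev (us @ [u]) (ws @ [e]) t = y t + z t"
        "known_dev (us @ [u]) (ws @ [- e]) t = y t - z t" if "t \<le> length us" for t
      using that Suc.prems by (simp_all add: known_dev_append y_def z_def vec.neg)
    have "\<Psi> (us @ [u]) (ws @ [e]) + \<Psi> (us @ [u]) (ws @ [- e])
        = (\<Sum>t<Suc (length us). (norm (y t + z t))\<^sup>2 + (norm (y t - z t))\<^sup>2)"
      unfolding \<Psi>_def sum.distrib using kd by (intro arg_cong2[where f = "(+)"] sum.cong) auto
    also have "\<dots> = (\<Sum>t<Suc (length us). 2 * (norm (y t))\<^sup>2 + 2 * (norm (z t))\<^sup>2)"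
      by (simp only: parallelogram)
    \<comment> \<open>For earlier controls only y is kept, for the newest only z: the new control
      may cancel y, but not z, whose sign is chosen afterwards.\<close>
    also have "\<dots> \<ge> (\<Sum>t<length us. 2 * (norm (y t))\<^sup>2) + 2 * (norm (z (length us)))\<^sup>2"
      unfolding sum.lessThan_Suc by (intro add_mono sum_mono) simp_all
    also have "(\<Sum>t<length us. 2 * (norm (y t))\<^sup>2) = 2 * \<Psi> us ws"
      unfolding \<Psi>_def sum_distrib_left y_def by (intro sum.cong) (auto simp: known_dev_append_controls)
    also have "z (length us) = d" using Suc.prems by (simp add: z_def d_def)
    finally have "\<Psi> us ws + (norm d)\<^sup>2 \<le> \<Psi> (us @ [u]) (ws @ [e]) \<or>
        \<Psi> us ws + (norm d)\<^sup>2 \<le> \<Psi> (us @ [u]) (ws @ [- e])" by linarith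
    then obtain w where w: "w \<in> \<Omega>" "\<Psi> us ws + (norm d)\<^sup>2 \<le> \<Psi> (us @ [u]) (ws @ [w])"
      using e by blast
    have "\<delta> * (\<Psi> us ws + real (Suc m) * (norm d)\<^sup>2) \<le> \<delta> * (\<Psi> (us @ [u]) (ws @ [w]) + real m * (norm d)\<^sup>2)"
      using w(2) \<delta>(1) by (intro mult_left_mono) (auto simp: algebra_simps)
    also have "ereal \<dots> \<le> minimax \<Omega> k ?g m (us @ [u]) (ws @ [w])"
      unfolding \<Psi>_def using Suc.prems by (intro Suc.IH) auto
    also have "\<dots> \<le> (SUP w\<in>\<Omega>. minimax \<Omega> k ?g m (us @ [u]) (ws @ [w]))"
      using w(1) by (rule SUP_upper)
    finally show "ereal (\<delta> * ((\<Sum>t<length us. (norm (known_dev us ws t))\<^sup>2) + real (Suc m) * (norm d)\<^sup>2))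
        \<le> (SUP w\<in>\<Omega>. minimax \<Omega> k ?g m (us @ [u]) (ws @ [w]))"
      by (simp add: \<Psi>_def)
  qed
qed

lemma opt_dynamic_regret_ge:
  assumes "Qf = P" "e \<in> \<Omega>" "- e \<in> \<Omega>" "0 \<le> \<delta>" "\<And>u. \<delta> * (norm u)\<^sup>2 \<le> u \<bullet> (G *v u)" "k \<le> T"
  shows "ereal (\<delta> * (real (T - k) * (norm (L *v (mat_pow (transpose F) k *v (P *v e))))\<^sup>2))
    \<le> opt_dynamic_regret A B Q R Qf x0 \<Omega> k T"
proof -
  \<comment> \<open>The first k disturbances are arbitrary, since the sum of deviations starts
    empty.\<close>
  have "replicate k e \<in> {ws. length ws = k \<and> set ws \<subseteq> \<Omega>}" using assms(2) by auto
  then show ?thesis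
    unfolding opt_dynamic_regret_def
    using minimax_ge[OF assms(1-5), where ws = "replicate k e" and us = "[]" and k = k and m = "T - k" and T = T] assms(6)
    by (intro SUP_upper2) auto
qed

end

section \<open>A scalar system inside arbitrary dimensions\<close>

definition unit_matrix :: "'m \<Rightarrow> 'n \<Rightarrow> real^'n^'m" where
  "unit_matrix i j = (\<chi> a b. if a = i \<and> b = j then 1 else 0)"

lemma unit_matrix_vec: "unit_matrix i j *v x = axis i (x $ j)"
proof -
  have "(\<Sum>b\<in>UNIV. (if a = i \<and> b = j then 1 else 0) * x $ b) = (if a = i then x $ j else 0)" for a
    by (subst sum.remove[of _ j]) (auto intro!: sum.neutral)
  then show ?thesis by (simp add: unit_matrix_def matrix_vector_mult_def axis_def vec_eq_iff)
qed

lemma transpose_unit_matrix: "transpose (unit_matrix i j) = unit_matrix j i"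
  by (auto simp: unit_matrix_def transpose_def vec_eq_iff)

lemma spectral_radius_0: "spectral_radius (0 :: real^'n^'n) < 1"
  unfolding spectral_radius_less_iff
proof
  fix c assume "c \<in> eigenvalues (0 :: real^'n^'n)"
  then obtain v where "v \<noteq> 0" "map_matrix complex_of_real (0 :: real^'n^'n) *v v = c *s v"
    by (auto simp: eigenvalues_def)
  moreover have "map_matrix complex_of_real (0 :: real^'n^'n) = 0"
    by (simp add: map_matrix_def vec_eq_iff)
  ultimately show "cmod c < 1" by simp
qed

lemma axis_arith:
  "axis i a + axis i b = axis i (a + b :: real)" "axis i a - axis i b = axis i (a - b :: real)"
  "c *\<^sub>R axis i a = axis i (c * a :: real)"
  by (auto simp: axis_def vec_eq_iff)

lemma norm_axis_real: "norm (axis i (a :: real)) = \<bar>a\<bar>"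
  by (simp add: norm_eq_sqrt_inner inner_axis_axis)

lemma matrix_inv_eqI:
  fixes M N :: "real^'n^'n"
  assumes "\<And>x. M *v (N *v x) = x"
  shows "matrix_inv M = N"
proof -
  have MN: "M ** N = mat 1" using assms by (simp add: matrix_eq matrix_vector_mul_assoc[symmetric])
  then have "invertible M" using matrix_left_right_inverse unfolding invertible_def by blast
  then show ?thesis
    using matrix_inv_vector(2)[of M] assms by (metis matrix_eq)
qed

(* The example is scalar, placed in the coordinate i of the state and j of the control:
   x' = x + u + w with weights 1/2 and 1, so that P = 1 and F = 1/2. *)
lemma regret_lower_bound_example:
  fixes i :: "'n::finite" and j :: "'d::finite"
  defines "E \<equiv> unit_matrix i i" and "B \<equiv> unit_matrix i j"
  defines "F \<equiv> closed_loop E B (mat 1) E"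
  shows "lqr_assumptions E B ((1/2) *\<^sub>R E) (mat 1) E"
    and "riccati_solution E B ((1/2) *\<^sub>R E) (mat 1) E"
    and "mat_pow F k \<noteq> 0"
    and "1 \<le> k \<Longrightarrow> k \<le> T \<Longrightarrow> ereal (1/4 * ((spectral_norm (mat_pow F k))\<^sup>2 * (real T - real k)))
           \<le> opt_dynamic_regret E B ((1/2) *\<^sub>R E) (mat 1) E 0 {axis i 1, - axis i 1} k T"
proof -
  have E: "E *v x = axis i (x $ i)" for x by (simp add: E_def unit_matrix_vec)
  have B: "B *v u = axis i (u $ j)" for u by (simp add: B_def unit_matrix_vec)
  have Bt: "transpose B *v x = axis j (x $ i)" for x
    unfolding B_def transpose_unit_matrix by (rule unit_matrix_vec)
  have Et: "transpose E = E" by (simp add: E_def transpose_unit_matrix)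
  define G where "G = mat 1 + transpose B ** E ** B"
  \<comment> \<open>G is the identity plus the matrix unit at (j, j), so its inverse merely halves
    the coordinate j.\<close>
  have "G *v ((mat 1 - (1/2) *\<^sub>R unit_matrix j j) *v u) = u" for u
    unfolding G_def matrix_vector_mult_add_rdistrib matrix_vector_mult_diff_rdistrib
      matrix_vector_mul_assoc[symmetric] scaleR_matrix_vector_assoc[symmetric] unit_matrix_vec B Bt E
    by (simp add: axis_def vec_eq_iff)
  then have Ginv: "matrix_inv G = mat 1 - (1/2) *\<^sub>R unit_matrix j j" by (rule matrix_inv_eqI)
  have Ginv_vec: "matrix_inv G *v axis j a = axis j (a / 2)" for a
    unfolding Ginv matrix_vector_mult_diff_rdistrib scaleR_matrix_vector_assoc[symmetric] unit_matrix_vec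
    by (simp add: axis_def vec_eq_iff)
  have psdE: "pos_semidef (c *\<^sub>R E)" if "0 \<le> c" for c
  proof -
    have "transpose (c *\<^sub>R E) = c *\<^sub>R transpose E" by (simp add: transpose_def vec_eq_iff)
    moreover have "x \<bullet> ((c *\<^sub>R E) *v x) = c * (x $ i * x $ i)" for x
      unfolding scaleR_matrix_vector_assoc[symmetric] E by (simp add: inner_axis)
    ultimately show ?thesis using that by (simp add: pos_semidef_def Et)
  qed
  have psd: "pos_semidef E" "pos_semidef ((1/2) *\<^sub>R E)" using psdE[of 1] psdE[of "1/2"] by simp_all
  have "E - B ** unit_matrix j i = 0"
    by (simp add: matrix_eq matrix_vector_mult_diff_rdistrib matrix_vector_mul_assoc[symmetric]
        unit_matrix_vec E B)
  then have stab: "stabilizable E B"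
    unfolding stabilizable_def by (intro exI[of _ "unit_matrix j i"]) (simp add: spectral_radius_0)
  have "transpose E - ((1/2) *\<^sub>R E) ** (2 *\<^sub>R E) = 0"
    by (simp add: matrix_eq matrix_vector_mult_diff_rdistrib matrix_vector_mul_assoc[symmetric]
        scaleR_matrix_vector_assoc[symmetric] E Et axis_arith)
  then have det: "detectable E ((1/2) *\<^sub>R E)"
    unfolding detectable_def stabilizable_def by (metis spectral_radius_0)
  have "pos_def (mat 1 :: real^'d^'d)" by (simp add: pos_def_def)
  then show lqr: "lqr_assumptions E B ((1/2) *\<^sub>R E) (mat 1) E"
    using psd stab det by (simp add: lqr_assumptions_def)
  \<comment> \<open>In the coordinate i this reads p = 1/2 + p - p^2 / (1 + p), solved by p =
    1.\<close>
  have "E = (1/2) *\<^sub>R E + transpose E ** E ** E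
      - transpose E ** E ** B ** matrix_inv (mat 1 + transpose B ** E ** B) ** transpose B ** E ** E"
    unfolding G_def[symmetric] Et matrix_eq matrix_vector_mult_diff_rdistrib
      matrix_vector_mult_add_rdistrib matrix_vector_mul_assoc[symmetric]
      scaleR_matrix_vector_assoc[symmetric] E B Bt Ginv_vec
    by (simp add: axis_arith Ginv_vec)
  with psd(1) show ric: "riccati_solution E B ((1/2) *\<^sub>R E) (mat 1) E"
    by (simp add: riccati_solution_def)
  \<comment> \<open>Terminal weight and Riccati solution are both E, as the lower bound
    requires.\<close>
  interpret ex: lqr E B "(1/2) *\<^sub>R E" "mat 1" E E 0 1
    using lqr ric by unfold_locales auto
  have Gex: "ex.G = G" by (simp add: ex.G_def G_def)
  have L: "ex.L *v x = axis j (x $ i / 2)" for x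
    unfolding ex.L_def Gex matrix_vector_mul_assoc[symmetric] Bt Ginv_vec ..
  have Fex: "ex.F = F" by (simp add: ex.F_def F_def)
  have F: "F *v x = axis i (x $ i / 2)" for x
    unfolding Fex[symmetric] ex.F_vec E B L by (simp add: axis_arith)
  have Ft: "transpose F = F"
  proof -
    have "F = (1/2) *\<^sub>R E"
      by (simp add: matrix_eq F E scaleR_matrix_vector_assoc[symmetric] axis_arith)
    moreover have "transpose ((1/2) *\<^sub>R E) = (1/2) *\<^sub>R transpose E"
      by (simp add: transpose_def vec_eq_iff)
    ultimately show ?thesis using Et by simp
  qed
  have pow_axis: "mat_pow F k *v axis i a = axis i (a / 2 ^ k)" for a k
    by (induction k) (simp_all add: matrix_vector_mul_assoc[symmetric] F mult.commute)
  \<comment> \<open>With a nilpotent F the lower bound would become trivial for large k.\<close>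
  have "mat_pow F k *v axis i 1 \<noteq> 0" by (simp add: pow_axis axis_eq_0_iff)
  then show "mat_pow F k \<noteq> 0" by auto
  assume k: "1 \<le> k" "k \<le> T"
  have "spectral_norm (mat_pow F k) \<le> 1 / 2 ^ k"
  proof (rule spectral_norm_le)
    fix x :: "real^'n"
    \<comment> \<open>At least one factor F is split off to project onto the coordinate i; the power
      0 is the identity and does not project.\<close>
    obtain k' where k': "k = Suc k'" using k by (cases k) auto
    have "mat_pow F k *v x = axis i (x $ i / 2 ^ k)"
      unfolding k' mat_pow_Suc_right F pow_axis by simp
    then show "norm (mat_pow F k *v x) \<le> 1 / 2 ^ k * norm x"
      using component_le_norm_cart[of x i] by (simp add: norm_axis_real divide_right_mono)
  qed
  then have sn: "(spectral_norm (mat_pow F k))\<^sup>2 \<le> (1 / 2 ^ k)\<^sup>2"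
    by (intro power_mono spectral_norm_nonneg)
  have G1: "1 * (norm u)\<^sup>2 \<le> u \<bullet> (ex.G *v u)" for u
    unfolding ex.G_quad using ex.quad_nonneg(3)[of "B *v u"] by (simp add: power2_norm_eq_inner)
  have "ex.L *v (mat_pow (transpose ex.F) k *v (E *v axis i 1)) = axis j (1 / 2 ^ k / 2)"
    unfolding Fex Ft E axis_nth pow_axis L ..
  \<comment> \<open>The constant 1/4 is the square of the factor 1/2 contributed by L.\<close>
  then have d: "(norm (ex.L *v (mat_pow (transpose ex.F) k *v (E *v axis i 1))))\<^sup>2 = 1/4 * (1 / 2 ^ k)\<^sup>2"
    by (simp add: norm_axis_real power_divide)
  have "1/4 * ((spectral_norm (mat_pow F k))\<^sup>2 * (real T - real k))
      \<le> 1 * (real (T - k) * (1/4 * (1 / 2 ^ k)\<^sup>2))"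
    using sn k mult_right_mono[OF sn, of "real T - real k"] by (simp add: mult_ac)
  moreover have "ereal (1 * (real (T - k) * (1/4 * (1 / 2 ^ k)\<^sup>2)))
      \<le> opt_dynamic_regret E B ((1/2) *\<^sub>R E) (mat 1) E 0 {axis i 1, - axis i 1} k T"
    unfolding d[symmetric] by (rule ex.opt_dynamic_regret_ge[OF refl _ _ _ G1 k(2)]) simp_all
  ultimately show "ereal (1/4 * ((spectral_norm (mat_pow F k))\<^sup>2 * (real T - real k)))
           \<le> opt_dynamic_regret E B ((1/2) *\<^sub>R E) (mat 1) E 0 {axis i 1, - axis i 1} k T"
    by (meson ereal_less_eq(3) order_trans)
qed

theorem theorem5p6:
  shows
   "(\<forall>(A :: real^'n^'n) (B :: real^'d^'n) (Q :: real^'n^'n) (R :: real^'d^'d)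
      (Qf :: real^'n^'n) (x0 :: real^'n) (\<Omega> :: (real^'n) set) (P :: real^'n^'n) F lam.
      lqr_assumptions A B Q R Qf \<and> riccati_solution A B Q R P
      \<and> F = closed_loop A B R P \<and> lam = (1 + spectral_radius F) / 2
      \<and> bounded \<Omega> \<and> \<Omega> \<noteq> {} \<longrightarrow>
        (\<exists>C>0. \<forall>k T. 1 \<le> k \<and> k \<le> T \<longrightarrow>
           \<bar>opt_dynamic_regret A B Q R Qf x0 \<Omega> k T\<bar>
             \<le> ereal (C * ((spectral_norm (mat_pow F k))\<^sup>2 * real T + 1)))
      \<and> (\<exists>C>0. \<forall>k T. 1 \<le> k \<and> k \<le> T \<longrightarrow>
           (spectral_norm (mat_pow F k))\<^sup>2 * real T + 1 \<le> C * (lam ^ (2 * k) * real T + 1))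
      \<and> (\<exists>C>0. \<forall>k T. 1 \<le> k \<and> k \<le> T \<longrightarrow>
           \<bar>opt_dynamic_regret A B Q R Qf x0 \<Omega> k T\<bar>
             \<le> ereal (C * (lam ^ (2 * k) * real T + 1))))
    \<and> (\<exists>(A :: real^'n^'n) (B :: real^'d^'n) (Q :: real^'n^'n) (R :: real^'d^'d)
      (Qf :: real^'n^'n) (x0 :: real^'n) (\<Omega> :: (real^'n) set) (P :: real^'n^'n) F.
      lqr_assumptions A B Q R Qf \<and> riccati_solution A B Q R P
      \<and> F = closed_loop A B R P \<and> bounded \<Omega> \<and> \<Omega> \<noteq> {}
      \<and> (\<forall>k. mat_pow F k \<noteq> 0)
      \<and> (\<exists>C>0. \<forall>k T. 1 \<le> k \<and> k \<le> T \<longrightarrow>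
           ereal (C * ((spectral_norm (mat_pow F k))\<^sup>2 * (real T - real k)))
             \<le> opt_dynamic_regret A B Q R Qf x0 \<Omega> k T))"
proof (intro conjI allI impI)
  fix A :: "real^'n^'n" and B :: "real^'d^'n" and Q :: "real^'n^'n" and R :: "real^'d^'d"
    and Qf :: "real^'n^'n" and x0 :: "real^'n" and \<Omega> :: "(real^'n) set" and P F :: "real^'n^'n"
    and lam :: real
  assume asm: "lqr_assumptions A B Q R Qf \<and> riccati_solution A B Q R P
      \<and> F = closed_loop A B R P \<and> lam = (1 + spectral_radius F) / 2 \<and> bounded \<Omega> \<and> \<Omega> \<noteq> {}"
  then obtain W where b: "0 < W" "\<And>x. x \<in> \<Omega> \<Longrightarrow> norm x \<le> W" by (metis bounded_pos)
  interpret lqr A B Q R Qf P x0 W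
    using asm b(1) by unfold_locales auto
  have F: "lqr.F A B R P = F" and lam: "lam = (1 + spectral_radius F) / 2"
    using asm by (simp_all add: F_def)
  obtain c where c: "0 < c" "\<And>k T. k \<le> T \<Longrightarrow> \<bar>opt_dynamic_regret A B Q R Qf x0 \<Omega> k T\<bar>
    \<le> ereal (c * ((spectral_norm (mat_pow F k))\<^sup>2 * real T + 1))"
    using opt_dynamic_regret_bounds[of \<Omega>] asm b(2) unfolding F by metis
  obtain c' where c': "0 < c'" "\<And>k T. (spectral_norm (mat_pow F k))\<^sup>2 * real T + 1
    \<le> c' * (lam ^ (2 * k) * real T + 1)"
    using spectral_norm_power_bound unfolding F lam by metis
  show "\<exists>C>0. \<forall>k T. 1 \<le> k \<and> k \<le> T \<longrightarrow> \<bar>opt_dynamic_regret A B Q R Qf x0 \<Omega> k T\<bar>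
      \<le> ereal (C * ((spectral_norm (mat_pow F k))\<^sup>2 * real T + 1))"
    using c by blast
  show "\<exists>C>0. \<forall>k T. 1 \<le> k \<and> k \<le> T \<longrightarrow>
      (spectral_norm (mat_pow F k))\<^sup>2 * real T + 1 \<le> C * (lam ^ (2 * k) * real T + 1)"
    using c' by blast
  show "\<exists>C>0. \<forall>k T. 1 \<le> k \<and> k \<le> T \<longrightarrow> \<bar>opt_dynamic_regret A B Q R Qf x0 \<Omega> k T\<bar>
      \<le> ereal (C * (lam ^ (2 * k) * real T + 1))"
  proof (intro exI[of _ "c * c'"] conjI allI impI)
    fix k T :: nat assume "1 \<le> k \<and> k \<le> T"
    then have "\<bar>opt_dynamic_regret A B Q R Qf x0 \<Omega> k T\<bar>
      \<le> ereal (c * ((spectral_norm (mat_pow F k))\<^sup>2 * real T + 1))" using c by blast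
    also have "\<dots> \<le> ereal (c * c' * (lam ^ (2 * k) * real T + 1))"
      using mult_left_mono[OF c'(2)[of k T], of c] c(1) by (simp add: mult.assoc)
    finally show "\<bar>opt_dynamic_regret A B Q R Qf x0 \<Omega> k T\<bar>
      \<le> ereal (c * c' * (lam ^ (2 * k) * real T + 1))" .
  qed (use c c' in simp)
next
  \<comment> \<open>Any coordinates will do; both index types are inhabited.\<close>
  define i :: 'n where "i = undefined"
  define j :: 'd where "j = undefined"
  define E :: "real^'n^'n" where "E = unit_matrix i i"
  define B :: "real^'d^'n" where "B = unit_matrix i j"
  define F where "F = closed_loop E B (mat 1) E"
  note ex = regret_lower_bound_example[where i = i and j = j, folded E_def B_def, folded F_def]
  have "\<exists>C>0. \<forall>k T. 1 \<le> k \<and> k \<le> T \<longrightarrow>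
      ereal (C * ((spectral_norm (mat_pow F k))\<^sup>2 * (real T - real k)))
        \<le> opt_dynamic_regret E B ((1/2) *\<^sub>R E) (mat 1) E 0 {axis i 1, - axis i 1} k T"
    by (rule exI[of _ "1/4"]) (simp add: ex(4)[simplified])
  then show "\<exists>(A :: real^'n^'n) (B :: real^'d^'n) (Q :: real^'n^'n) (R :: real^'d^'d)
      (Qf :: real^'n^'n) (x0 :: real^'n) (\<Omega> :: (real^'n) set) (P :: real^'n^'n) F.
      lqr_assumptions A B Q R Qf \<and> riccati_solution A B Q R P
      \<and> F = closed_loop A B R P \<and> bounded \<Omega> \<and> \<Omega> \<noteq> {}
      \<and> (\<forall>k. mat_pow F k \<noteq> 0)
      \<and> (\<exists>C>0. \<forall>k T. 1 \<le> k \<and> k \<le> T \<longrightarrow>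
           ereal (C * ((spectral_norm (mat_pow F k))\<^sup>2 * (real T - real k)))
             \<le> opt_dynamic_regret A B Q R Qf x0 \<Omega> k T)"
    by (intro exI[of _ E] exI[of _ B] exI[of _ "(1/2) *\<^sub>R E"] exI[of _ "mat 1"] exI[of _ 0]
        exI[of _ "{axis i 1, - axis i 1}"] exI[of _ F])
      (use ex(1-3) in \<open>simp add: F_def\<close>)
qed

end
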